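(* \textsc{Max Dense Graph Partition} is solvable in polynomial time on graphs $G$ with $n$ vertices and minimum degree $\delta(G)\ge n-3$.
   Context: All graphs are finite, simple, undirected. For $S\subseteq V$, $d(S)=|E(S)|/|S|$ where $E(S)$ is the set of edges with both endpoints in $S$. For a partition $\mathcal{P}=\{V_1,\dots,V_k\}$ ($k\ge1$) of $V$ into nonempty parts, $d(\mathcal{P})=\sum_i d(V_i)$. \textsc{Max Dense Graph Partition}: given $G$, find a partition of $V$ (any number of parts) maximizing $d(\mathcal{P})$. *)

theory Defs
  imports
    Complex_Main
    "HOL-Library.Disjoint_Sets"
    "HOL-Computational_Algebra.Polynomial"
begin

definition simple_graph :: "'a set \<Rightarrow> 'a set set \<Rightarrow> bool" where
  "simple_graph V E \<longleftrightarrow> finite V \<and> (\<forall>e\<in>E. e \<subseteq> V \<and> card e = 2)"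

definition vertex_degree :: "'a set set \<Rightarrow> 'a \<Rightarrow> nat" where
  "vertex_degree E v = card {e \<in> E. v \<in> e}"

definition min_degree :: "'a set \<Rightarrow> 'a set set \<Rightarrow> nat" where
  "min_degree V E = Min (vertex_degree E ` V)"

definition density :: "'a set set \<Rightarrow> 'a set \<Rightarrow> real" where
  "density E S = real (card {e \<in> E. e \<subseteq> S}) / real (card S)"

definition partition_density :: "'a set set \<Rightarrow> 'a set set \<Rightarrow> real" where
  "partition_density E P = (\<Sum>S\<in>P. density E S)"

definition max_dense_partition :: "'a set \<Rightarrow> 'a set set \<Rightarrow> 'a set set \<Rightarrow> bool" where
  "max_dense_partition V E P \<longleftrightarrow>
     partition_on V P \<and>
     (\<forall>Q. partition_on V Q \<longrightarrow> partition_density E Q \<le> partition_density E P)"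

text \<open>
  The machine model is a unit-cost random access machine on natural numbers, with structured
  control flow. Every variable is an array indexed by the natural numbers; a scalar variable is
  the entry at index \<open>0\<close>. The only arithmetic operations are addition and truncated
  subtraction. As the expressions of a fixed program have bounded size, the bit length of the
  largest number in the store grows by at most a constant in each step, so that time on
  this machine is polynomially related to time on a Turing machine; with multiplication at unit
  cost this would not be the case.
\<close>

type_synonym vname = string
type_synonym store = "vname \<Rightarrow> nat \<Rightarrow> nat"

datatype aexp =
    Num nat
  | Entry vname aexp
  | Plus aexp aexp
  | Minus aexp aexp

datatype bexp =
    Less aexp aexp
  | Equal aexp aexp
  | Neg bexp
  | Conj bexp bexp

datatype com =
    Skip
  | Assign vname aexp aexp
  | Seq com com
  | Cond bexp com com
  | While bexp com

fun aval :: "aexp \<Rightarrow> store \<Rightarrow> nat" where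
  "aval (Num k) s = k"
| "aval (Entry x a) s = s x (aval a s)"
| "aval (Plus a b) s = aval a s + aval b s"
| "aval (Minus a b) s = aval a s - aval b s"

fun bval :: "bexp \<Rightarrow> store \<Rightarrow> bool" where
  "bval (Less a b) s \<longleftrightarrow> aval a s < aval b s"
| "bval (Equal a b) s \<longleftrightarrow> aval a s = aval b s"
| "bval (Neg b) s \<longleftrightarrow> \<not> bval b s"
| "bval (Conj b c) s \<longleftrightarrow> bval b s \<and> bval c s"

text \<open>
  \<open>exec c s t s'\<close>: started in store \<open>s\<close>, the program \<open>c\<close> terminates after \<open>t\<close> steps in
  store \<open>s'\<close>. The command \<open>Assign x i a\<close> is \<open>x[i] := a\<close>.
\<close>

inductive exec :: "com \<Rightarrow> store \<Rightarrow> nat \<Rightarrow> store \<Rightarrow> bool" where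
  Skip: "exec Skip s 1 s"
| Assign: "exec (Assign x i a) s 1 (s(x := (s x)(aval i s := aval a s)))"
| Seq: "exec c1 s t1 s' \<Longrightarrow> exec c2 s' t2 s'' \<Longrightarrow> exec (Seq c1 c2) s (t1 + t2) s''"
| CondTrue: "bval b s \<Longrightarrow> exec c1 s t s' \<Longrightarrow> exec (Cond b c1 c2) s (1 + t) s'"
| CondFalse: "\<not> bval b s \<Longrightarrow> exec c2 s t s' \<Longrightarrow> exec (Cond b c1 c2) s (1 + t) s'"
| WhileFalse: "\<not> bval b s \<Longrightarrow> exec (While b c) s 1 s"
| WhileTrue: "bval b s \<Longrightarrow> exec c s t1 s' \<Longrightarrow> exec (While b c) s' t2 s'' \<Longrightarrow>
    exec (While b c) s (1 + t1 + t2) s''"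

definition input_store :: "nat list \<Rightarrow> store" where
  "input_store xs x i =
     (if x = ''input'' \<and> i < length xs then xs ! i
      else if x = ''input_length'' \<and> i = 0 then length xs
      else 0)"

definition output_of :: "store \<Rightarrow> nat list" where
  "output_of s = map (s ''output'') [0..<s ''output_length'' 0]"

text \<open>
  \<open>poly_time_solvable enc sol I\<close>: for some program and some polynomial, the program
  run on the encoding of any instance in \<open>I\<close> halts with a solution of that instance, in time
  polynomial in the length of the encoding. The output length is bounded explicitly because
  \<open>output_length\<close> could be set to an exponentially large number in few steps.
\<close>

definition poly_time_solvable ::
    "('i \<Rightarrow> nat list) \<Rightarrow> ('i \<Rightarrow> nat list \<Rightarrow> bool) \<Rightarrow> 'i set \<Rightarrow> bool" where
  "poly_time_solvable enc sol I \<longleftrightarrow>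
     (\<exists>(c :: com) (p :: nat poly). \<forall>x\<in>I. \<exists>t s.
        exec c (input_store (enc x)) t s \<and>
        t \<le> poly p (length (enc x)) \<and>
        length (output_of s) \<le> poly p (length (enc x)) \<and>
        sol x (output_of s))"

text \<open>
  An instance \<open>(n, E)\<close> is the graph with vertex set \<open>{..<n}\<close> and edge set \<open>E\<close>, given to the
  machine as \<open>n\<close> followed by its adjacency matrix, row by row. A partition is output as a list of
  \<open>n\<close> labels: two vertices are in the same part iff they have the same label.
\<close>

definition encode_graph :: "nat \<times> nat set set \<Rightarrow> nat list" where
  "encode_graph = (\<lambda>(n, E).
     n # map (\<lambda>k. if {k div n, k mod n} \<in> E then 1 else 0) [0..<n * n])"

definition label_classes :: "nat list \<Rightarrow> nat set set" where
  "label_classes ys = (\<lambda>l. {v. v < length ys \<and> ys ! v = l}) ` set ys"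

definition MaxDenseGraphPartition :: "nat \<times> nat set set \<Rightarrow> nat list \<Rightarrow> bool" where
  "MaxDenseGraphPartition = (\<lambda>(n, E) ys.
     length ys = n \<and> max_dense_partition {..<n} E (label_classes ys))"

end

theory Submission
  imports Defs
begin

text \<open>
  The non-edges form a graph of maximum degree 2, a disjoint union of paths and cycles. If a part
  \<open>S\<close> contains \<open>m(S)\<close> non-edges, then
  \<open>d(P) = (n - |P|) / 2 - (\<Sum>S\<in>P. m(S) / |S|)\<close>, and since \<open>m(V) \<le> n\<close>, three or more parts
  never beat a single one. For two parts, colour the paths and cycles of non-edges
  alternately with 1 and 2, starting with colour 1, each path at an end point. Then part 1, say
  \<open>A\<close>, has \<open>m(A)\<close> non-edges, one for every odd cycle, and part 2 has none. Every set \<open>S\<close>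
  satisfies \<open>|S| - m(S) \<le> |A| - m(A)\<close> and \<open>m(A) \<le> m(S) + m(V - S)\<close>, and these
  inequalities, with \<open>m(A) \<le> |A|\<close>, imply \<open>m(A) / |A| \<le> m(S) / |S| + m(V - S) / |V - S|\<close>. Both of
  them are maintained vertex by vertex along the walk, so that paths and cycles need not be
  classified.
\<close>

section \<open>Colouring graphs of maximum degree two\<close>

locale two_sparse =
  fixes V :: "'a set" and N :: "'a \<Rightarrow> 'a \<Rightarrow> bool"
  assumes finite_V: "finite V"
    and sym: "N u v \<Longrightarrow> N v u"
    and irrefl: "\<not> N u u"
    and deg_le_2: "u \<in> V \<Longrightarrow> card {v \<in> V. N u v} \<le> 2"
begin

text \<open>Ordered pairs: every non-edge inside \<open>S\<close> is counted twice.\<close>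

definition pairs :: "'a set \<Rightarrow> nat" where
  "pairs S = card {(u, v). u \<in> S \<and> v \<in> S \<and> N u v}"

lemma pairs_empty [simp]: "pairs {} = 0"
  by (simp add: pairs_def)

lemma pairs_insert:
  assumes "finite S" "v \<notin> S"
  shows "pairs (insert v S) = pairs S + 2 * card {u \<in> S. N v u}"
proof -
  let ?B = "{u \<in> S. N v u}"
  have eq: "{(x, y). x \<in> insert v S \<and> y \<in> insert v S \<and> N x y} =
      {(x, y). x \<in> S \<and> y \<in> S \<and> N x y} \<union> (Pair v ` ?B \<union> (\<lambda>u. (u, v)) ` ?B)"
    using irrefl sym by auto
  have fin: "finite {(x, y). x \<in> S \<and> y \<in> S \<and> N x y}"
    by (rule finite_subset[of _ "S \<times> S"]) (use assms in auto)
  have "card (Pair v ` ?B \<union> (\<lambda>u. (u, v)) ` ?B) = card (Pair v ` ?B) + card ((\<lambda>u. (u, v)) ` ?B)"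
    by (rule card_Un_disjoint) (use assms in auto)
  also have "\<dots> = 2 * card ?B"
    by (simp add: card_image inj_on_def)
  finally have c: "card (Pair v ` ?B \<union> (\<lambda>u. (u, v)) ` ?B) = 2 * card ?B" .
  show ?thesis
    unfolding pairs_def eq
    by (subst card_Un_disjoint) (use assms fin c in auto)
qed

lemma pairs_insert_ge:
  assumes "finite S" "v \<notin> S"
  shows "pairs S \<le> pairs (insert v S)"
  using pairs_insert[OF assms] by simp

lemma pairs_insert_ge_2:
  assumes "finite S" "v \<notin> S" "u \<in> S" "N v u"
  shows "pairs S + 2 \<le> pairs (insert v S)"
proof -
  have "card {u \<in> S. N v u} \<noteq> 0"
    using assms by auto
  then show ?thesis
    using pairs_insert[OF assms(1,2)] by linarith
qed

text \<open>Each vertex of \<open>S\<close> is the first component of at most two pairs, as it has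
  at most two non-neighbours in all of \<open>V\<close>.\<close>

lemma pairs_le_twice_card:
  assumes "S \<subseteq> V"
  shows "pairs S \<le> 2 * card S"
proof -
  have fS: "finite S" using assms finite_V finite_subset by blast
  have "{(u, v). u \<in> S \<and> v \<in> S \<and> N u v} = Sigma S (\<lambda>u. {v \<in> S. N u v})"
    by auto
  then have "pairs S = (\<Sum>u\<in>S. card {v \<in> S. N u v})"
    unfolding pairs_def using fS by simp
  also have "\<dots> \<le> (\<Sum>u\<in>S. 2)"
  proof (rule sum_mono)
    fix u assume "u \<in> S"
    have "card {v \<in> S. N u v} \<le> card {v \<in> V. N u v}"
      by (rule card_mono) (use assms finite_V in auto)
    then show "card {v \<in> S. N u v} \<le> 2"
      using deg_le_2[of u] \<open>u \<in> S\<close> assms by force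
  qed
  finally show ?thesis by simp
qed

lemma no_third_neighbour:
  assumes "u \<in> V" "a \<in> V" "b \<in> V" "c \<in> V" "N u a" "N u b" "N u c" "a \<noteq> b" "c \<noteq> a" "c \<noteq> b"
  shows False
proof -
  have "card {a, b, c} \<le> card {v \<in> V. N u v}"
    by (rule card_mono) (use assms finite_V in auto)
  then show False
    using deg_le_2[of u] assms by simp
qed

section \<open>Invariants of the alternating colouring along a walk\<close>

text \<open>The last two conjuncts are the two inequalities of the overview relative to the coloured
  set \<open>U\<close>. The factors 2 are there because \<open>pairs\<close> counts both
  orientations of a non-edge.\<close>

definition bounds :: "'a set \<Rightarrow> 'a set \<Rightarrow> bool" where
  "bounds U A \<longleftrightarrow> A \<subseteq> U \<and> U \<subseteq> V \<and>
    (\<forall>u\<in>U - A. \<forall>v\<in>U - A. \<not> N u v) \<and>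
    (\<forall>S\<subseteq>U. 2 * card S + pairs A \<le> 2 * card A + pairs S) \<and>
    (\<forall>S\<subseteq>U. pairs A \<le> pairs S + pairs (U - S))"

text \<open>
  The strengthening of \<open>bounds\<close> that carries the induction while the walk from \<open>s\<close> to \<open>w\<close>
  can still be continued: a set that avoids the ends as stated, or separates them differently from
  \<open>A\<close>, misses the optimum by a whole vertex or edge.
\<close>

definition end_bounds :: "'a set \<Rightarrow> 'a set \<Rightarrow> 'a \<Rightarrow> 'a \<Rightarrow> bool" where
  "end_bounds U A s w \<longleftrightarrow>
    (\<forall>S\<subseteq>U. w \<in> A \<and> w \<notin> S \<longrightarrow> 2 * card S + pairs A + 2 \<le> 2 * card A + pairs S) \<and>
    (\<forall>S\<subseteq>U. s \<notin> S \<and> (w \<in> A \<or> w \<notin> S) \<longrightarrow> 2 * card S + pairs A + 2 \<le> 2 * card A + pairs S) \<and>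
    (\<forall>S\<subseteq>U. ((s \<in> S) = (w \<in> S)) \<noteq> (w \<in> A) \<longrightarrow> pairs A + 2 \<le> pairs S + pairs (U - S))"

definition saturated :: "'a set \<Rightarrow> 'a \<Rightarrow> bool" where
  "saturated U u \<longleftrightarrow> (\<forall>v\<in>V - U. \<not> N u v)"

text \<open>Here \<open>U\<close> consists of finished components and of the stretch walked from
  \<open>s\<close> to \<open>w\<close>. The last two clauses concern walks that get stuck: then
  \<open>s\<close> has no uncoloured non-neighbour either. This works because the walk began at a
  vertex with at most one non-neighbour or else every uncoloured vertex has two.\<close>

definition walk :: "'a set \<Rightarrow> 'a \<Rightarrow> 'a \<Rightarrow> bool" where
  "walk U s w \<longleftrightarrow> s \<in> U \<and> w \<in> U \<and> U \<subseteq> V \<and>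
    (\<forall>u\<in>U - {s, w}. saturated U u) \<and>
    (w \<noteq> s \<longrightarrow> (\<exists>u\<in>U. N w u) \<and> (\<exists>u\<in>U. N s u)) \<and>
    (saturated U w \<longrightarrow> saturated U s) \<and>
    (card {v \<in> V. N s v} \<le> 1 \<or> (\<forall>u\<in>V - U. card {v \<in> V. N u v} = 2))"

lemma walk_start:
  assumes "U \<subseteq> V" "\<forall>u\<in>U. saturated U u" "v \<in> V - U"
    and "card {u \<in> V. N v u} \<le> 1 \<or> (\<forall>u\<in>V - U. 2 \<le> card {v \<in> V. N u v})"
  shows "walk (insert v U) v v"
  using assms deg_le_2 unfolding walk_def saturated_def
  by (auto simp: le_antisym)

text \<open>Since \<open>U\<close> is saturated, \<open>v\<close> has no non-neighbour in it and
  creates no pairs. Adding \<open>v\<close> to \<open>A\<close> gains one vertex for free, and a set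
  that misses \<open>v\<close> falls behind by that vertex, which is the slack in
  \<open>end_bounds\<close>.\<close>

lemma bounds_start:
  assumes b: "bounds U A" and sat: "\<forall>u\<in>U. saturated U u" and v: "v \<in> V - U"
  shows "bounds (insert v U) (insert v A)" "end_bounds (insert v U) (insert v A) v v"
proof -
  have AU: "A \<subseteq> U" and UV: "U \<subseteq> V" and vU: "v \<notin> U" "v \<notin> A"
    using b v unfolding bounds_def by auto
  have nb: "\<not> N v u" if "u \<in> U" for u
    using sat v that sym unfolding saturated_def by blast
  have fin: "finite S" if "S \<subseteq> U" for S
    using that UV finite_V by (meson finite_subset)
  have pv: "pairs (insert v S) = pairs S" if "S \<subseteq> U" for S
  proof -
    have "{u \<in> S. N v u} = {}" using nb that by auto
    then show ?thesis using pairs_insert[OF fin[OF that], of v] that vU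
      by (metis (no_types, lifting) add_0_right card.empty mult_0_right subsetD)
  qed
  have cv: "card (insert v S) = Suc (card S)" if "S \<subseteq> U" for S
    using fin[OF that] vU that by (auto simp: card_insert_if)
  have phi: "2 * card S + pairs A \<le> 2 * card A + pairs S"
    and mono: "pairs A \<le> pairs S + pairs (U - S)" if "S \<subseteq> U" for S
    using b that unfolding bounds_def by auto
  have split: "S - {v} \<subseteq> U \<and> (S = S - {v} \<or> S = insert v (S - {v}))" if "S \<subseteq> insert v U" for S
    using that by auto
  have diff: "insert v U - S = (if v \<in> S then U - (S - {v}) else insert v (U - S))"
    if "S \<subseteq> insert v U" for S
    using vU by auto
  have phi': "2 * card S + pairs A \<le> 2 * card A + pairs S + (if v \<in> S then 2 else 0)"
    if "S \<subseteq> insert v U" for S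
  proof (cases "v \<in> S")
    case True
    then have "S = insert v (S - {v})" by auto
    then show ?thesis
      using True phi[of "S - {v}"] pv[of "S - {v}"] cv[of "S - {v}"] split[OF that] by simp
  next
    case False
    then show ?thesis using that phi[of S] by auto
  qed
  have mono': "pairs A \<le> pairs S + pairs (insert v U - S)" if "S \<subseteq> insert v U" for S
  proof (cases "v \<in> S")
    case True
    then have "S = insert v (S - {v})" by auto
    then have "pairs S = pairs (S - {v})"
      using pv[of "S - {v}"] split[OF that] by simp
    then show ?thesis
      using True mono[of "S - {v}"] split[OF that] diff[OF that] by simp
  next
    case False
    then show ?thesis using that mono[of S] diff[OF that] pv[of "U - S"] by auto
  qed
  show "bounds (insert v U) (insert v A)"
    unfolding bounds_def
  proof (intro conjI allI impI)
    show "insert v A \<subseteq> insert v U" using AU by auto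
    show "insert v U \<subseteq> V" using UV v by auto
    show "\<forall>u\<in>insert v U - insert v A. \<forall>x\<in>insert v U - insert v A. \<not> N u x"
      using b unfolding bounds_def by auto
    fix S assume S: "S \<subseteq> insert v U"
    show "2 * card S + pairs (insert v A) \<le> 2 * card (insert v A) + pairs S"
      using phi'[OF S] cv[OF AU] pv[OF AU] by (simp split: if_splits)
    show "pairs (insert v A) \<le> pairs S + pairs (insert v U - S)"
      using mono'[OF S] pv[OF AU] by simp
  qed
  show "end_bounds (insert v U) (insert v A) v v"
  proof -
    have "2 * card S + pairs A \<le> 2 * card A + pairs S" if "S \<subseteq> insert v U" "v \<notin> S" for S
      using phi'[OF that(1)] that(2) by simp
    then show ?thesis
      unfolding end_bounds_def using cv[OF AU] pv[OF AU] by simp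
  qed
qed

text \<open>Unless \<open>w\<close> is the start, it now has both its predecessor and
  \<open>v\<close> as coloured non-neighbours, hence no others. The delicate clause is that
  \<open>v\<close> gets stuck only when \<open>s\<close> is saturated too.\<close>

lemma walk_extend:
  assumes wk: "walk U s w" and v: "v \<in> V - U" and wv: "N w v"
  shows "walk (insert v U) s v"
proof -
  have sU: "s \<in> U" and wU: "w \<in> U" and UV: "U \<subseteq> V"
    and in_sat: "\<And>u. u \<in> U \<Longrightarrow> u \<noteq> s \<Longrightarrow> u \<noteq> w \<Longrightarrow> saturated U u"
    and nbs: "w \<noteq> s \<Longrightarrow> (\<exists>u\<in>U. N w u) \<and> (\<exists>u\<in>U. N s u)"
    and dg: "card {v \<in> V. N s v} \<le> 1 \<or> (\<forall>u\<in>V - U. card {v \<in> V. N u v} = 2)"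
    using wk unfolding walk_def by auto
  have vw: "N v w" using wv sym by blast
  have sat_w: "saturated (insert v U) w" if ws: "w \<noteq> s"
    unfolding saturated_def
  proof (intro ballI notI)
    fix x assume x: "x \<in> V - insert v U" "N w x"
    obtain u where "u \<in> U" "N w u" using nbs ws by blast
    then show False
      using no_third_neighbour[of w u v x] x v wv wU UV by auto
  qed
  have s_nb: "\<exists>u\<in>insert v U. N s u"
    using nbs wv by (cases "w = s") auto
  have sat_s: "saturated (insert v U) s" if sv: "saturated (insert v U) v"
  proof (cases "card {v \<in> V. N s v} \<le> 1")
    case True
    \<comment> \<open>The start is the end of a path: its only non-neighbour is already
      coloured.\<close>
    obtain u where u: "u \<in> insert v U" "N s u" using s_nb by auto
    show ?thesis
      unfolding saturated_def
    proof (intro ballI notI)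
      fix x assume x: "x \<in> V - insert v U" "N s x"
      have "card {u, x} \<le> card {v \<in> V. N s v}"
        by (rule card_mono) (use u x v UV finite_V in auto)
      moreover have "u \<noteq> x" using u x by auto
      ultimately show False using True by simp
    qed
  next
    case False
    then have c2: "card {x \<in> V. N v x} = 2" using dg v by auto
    \<comment> \<open>A stuck \<open>v\<close> has both its non-neighbours in \<open>U\<close>,
      where they were unsaturated, so they can only be the ends of the walk. Thus \<open>v\<close>
      closes a cycle through \<open>s\<close>.\<close>
    have sub: "{x \<in> V. N v x} \<subseteq> {s, w}"
    proof
      fix x assume "x \<in> {x \<in> V. N v x}"
      then have x: "x \<in> V" "N v x" by auto
      then have "x \<in> U" using sv irrefl unfolding saturated_def by auto
      moreover have "\<not> saturated U x" using x v sym unfolding saturated_def by blast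
      ultimately show "x \<in> {s, w}" using in_sat by auto
    qed
    have "card {s, w} \<ge> 2"
      using card_mono[OF _ sub] c2 by simp
    then have ws: "w \<noteq> s" by auto
    have "{x \<in> V. N v x} = {s, w}"
      by (rule card_subset_eq) (use sub c2 ws in auto)
    then have "N v s" using sU UV by auto
    then have Nsv: "N s v" using sym by blast
    obtain u where "u \<in> U" "N s u" using nbs ws by blast
    then show ?thesis
      using no_third_neighbour[of s u v] Nsv v sU UV unfolding saturated_def by blast
  qed
  show ?thesis
    unfolding walk_def
  proof (intro conjI)
    show "\<forall>u\<in>insert v U - {s, v}. saturated (insert v U) u"
      using in_sat sat_w unfolding saturated_def by blast
  qed (use sU wU UV v vw s_nb sat_s dg in auto)
qed

text \<open>Only \<open>s\<close> and \<open>w\<close> can be non-neighbours of \<open>v\<close> in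
  \<open>U\<close>. Colour 2 changes nothing in \<open>A\<close>; colour 1 adds a vertex to
  \<open>A\<close>, and also a non-edge if an odd cycle closes. When a set S or its complement
  receives \<open>v\<close>, the comparison is saved by a new non-edge at \<open>v\<close> or by the
  slack in \<open>end_bounds\<close>.\<close>

lemma bounds_extend:
  assumes wk: "walk U s w" and b: "bounds U A" and eb: "end_bounds U A s w" and sA: "s \<in> A"
    and v: "v \<in> V - U" and wv: "N w v"
  defines "A' \<equiv> if w \<in> A then A else insert v A"
  shows "bounds (insert v U) A'"
    and "saturated (insert v U) v \<or> end_bounds (insert v U) A' s v"
proof -
  have wU: "w \<in> U" and sU: "s \<in> U"
    and in_sat: "\<And>u. u \<in> U \<Longrightarrow> u \<noteq> s \<Longrightarrow> u \<noteq> w \<Longrightarrow> saturated U u"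
    using wk unfolding walk_def by auto
  have AU: "A \<subseteq> U" and UV: "U \<subseteq> V" and vU: "v \<notin> U" "v \<notin> A" "v \<noteq> s"
    using b v sU unfolding bounds_def by auto
  have vw: "N v w" using wv sym by blast
  have nb: "u = s \<or> u = w" if "u \<in> U" "N v u" for u
    using in_sat[of u] that v sym unfolding saturated_def by blast
  have fin: "finite S" if "S \<subseteq> U" for S
    using that UV finite_V by (meson finite_subset)
  have cv: "card (insert v S) = Suc (card S)" if "S \<subseteq> U" for S
    using fin[OF that] vU that by (auto simp: card_insert_if)
  have pge: "pairs S \<le> pairs (insert v S)" if "S \<subseteq> U" for S
    using pairs_insert_ge[OF fin[OF that], of v] that vU by auto
  have pge2: "pairs S + 2 \<le> pairs (insert v S)" if "S \<subseteq> U" "u \<in> S" "N v u" for S u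
    using pairs_insert_ge_2[OF fin[OF that(1)], of v u] that vU by auto
  have phi: "2 * card S + pairs A \<le> 2 * card A + pairs S"
    and mono: "pairs A \<le> pairs S + pairs (U - S)" if "S \<subseteq> U" for S
    using b that unfolding bounds_def by auto
  have phi_w: "2 * card S + pairs A + 2 \<le> 2 * card A + pairs S"
    if "S \<subseteq> U" "w \<in> A" "w \<notin> S" for S
    using eb that unfolding end_bounds_def by blast
  have phi_s: "2 * card S + pairs A + 2 \<le> 2 * card A + pairs S"
    if "S \<subseteq> U" "s \<notin> S" "w \<in> A \<or> w \<notin> S" for S
    using eb that unfolding end_bounds_def by blast
  have mono2: "pairs A + 2 \<le> pairs S + pairs (U - S)"
    if "S \<subseteq> U" "((s \<in> S) = (w \<in> S)) \<noteq> (w \<in> A)" for S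
    using eb that unfolding end_bounds_def by blast
  have indep: "\<not> N x y" if "x \<in> U - A" "y \<in> U - A" for x y
    using b that unfolding bounds_def by auto
  have indep': "\<forall>x\<in>insert v U - A'. \<forall>y\<in>insert v U - A'. \<not> N x y"
  proof (cases "w \<in> A")
    case True
    then have "\<not> N v y" if "y \<in> U - A" for y using nb[of y] that sA by auto
    then show ?thesis
      using True indep irrefl sym unfolding A'_def by (metis Diff_iff insertE)
  next
    case False
    then show ?thesis using indep unfolding A'_def by auto
  qed
  have A'U: "A' \<subseteq> insert v U" "insert v U \<subseteq> V"
    using AU UV v unfolding A'_def by auto
  have cases_S: thesis
    if "S \<subseteq> insert v U" "S \<subseteq> U \<Longrightarrow> thesis" "\<And>T. T \<subseteq> U \<Longrightarrow> S = insert v T \<Longrightarrow> thesis" for S thesis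
  proof (cases "v \<in> S")
    case True
    then show thesis using that(1) that(3)[of "S - {v}"] by auto
  next
    case False
    then show thesis using that(1,2) by auto
  qed
  have diff: "insert v U - S = insert v (U - S)" "insert v U - insert v S = U - S" if "S \<subseteq> U" for S
    using vU that by auto
  \<comment> \<open>The vertex \<open>v\<close> is paid for by a new pair with \<open>w\<close> or
    \<open>s\<close>, or by the slack of a set that misses an end.\<close>
  have phi_v: "2 * card (insert v S) + pairs A \<le> 2 * card A + pairs (insert v S)"
    if S: "S \<subseteq> U" and h: "w \<in> A \<or> s \<notin> S \<or> N v s" for S
  proof -
    consider "w \<in> S" | "w \<notin> S" "s \<notin> S" | "w \<notin> S" "s \<in> S" "w \<in> A" | "w \<notin> S" "s \<in> S" "N v s"
      using h by blast
    then show ?thesis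
    proof cases
      case 1 then show ?thesis using phi[OF S] pge2[OF S _ vw] cv[OF S] by linarith
    next
      case 2 then show ?thesis using phi_s[OF S] pge[OF S] cv[OF S] by simp
    next
      case 3 then show ?thesis using phi_w[OF S] pge[OF S] cv[OF S] by simp
    next
      case 4 then show ?thesis using phi[OF S] pge2[OF S, of s] cv[OF S] by linarith
    qed
  qed
  have phi_v': "2 * card (insert v S) + pairs A \<le> 2 * card A + pairs (insert v S) + 2"
    if S: "S \<subseteq> U" for S
    using phi[OF S] pge[OF S] cv[OF S] by simp
  have mono_v: "pairs A \<le> pairs (insert v S) + pairs (insert v U - insert v S)"
       "pairs A \<le> pairs S + pairs (insert v U - S)" if S: "S \<subseteq> U" for S
    using mono[OF S] diff[OF S] pge[OF S] pge[of "U - S"] by auto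
  \<comment> \<open>Either \<open>v\<close> shares its side with a non-neighbour, which gives a new
    pair, or the ends are distributed differently from \<open>A\<close>, which gives slack.\<close>
  have mono_v2: "pairs A + 2 \<le> pairs (insert v S) + pairs (insert v U - insert v S)"
    if S: "S \<subseteq> U" and "((s \<in> S) = (w \<in> S)) \<noteq> (w \<in> A) \<or> w \<in> S \<or> s \<in> S \<and> N v s" for S
    using mono2[OF S] mono[OF S] diff[OF S] pge[OF S] pge2[OF S _ vw] pge2[OF S, of s] that(2)
    by fastforce
  have mono_v2': "pairs A + 2 \<le> pairs S + pairs (insert v U - S)"
    if S: "S \<subseteq> U" and "((s \<in> S) = (w \<in> S)) \<noteq> (w \<in> A) \<or> w \<notin> S \<or> s \<notin> S \<and> N v s" for S
    using mono2[OF S] mono[OF S] diff[OF S] pge[of "U - S"] pge2[of "U - S" w] vw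
      pge2[of "U - S" s] that(2) wU sU
    by fastforce
  have notin: "v \<notin> S" if "S \<subseteq> U" for S
    using that vU by auto
  have cA: "card (insert v A) = Suc (card A)"
    using cv[OF AU] .
  consider (B) "w \<in> A" | (A) "w \<notin> A" "\<not> N v s" | (close) "w \<notin> A" "N v s" by blast
  then have "bounds (insert v U) A' \<and> (saturated (insert v U) v \<or> end_bounds (insert v U) A' s v)"
  proof cases
    case B
    then have A': "A' = A" unfolding A'_def by simp
    have "2 * card S + pairs A \<le> 2 * card A + pairs S" if "S \<subseteq> insert v U" for S
      using that by (rule cases_S) (use B phi phi_v in auto)
    moreover have "pairs A \<le> pairs S + pairs (insert v U - S)" if "S \<subseteq> insert v U" for S
      using that by (rule cases_S) (use mono_v in blast)+
    moreover have "2 * card S + pairs A + 2 \<le> 2 * card A + pairs S"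
      if "S \<subseteq> insert v U" "s \<notin> S" "v \<notin> S" for S
      using that(1) by (rule cases_S) (use B phi_s that in auto)
    \<comment> \<open>Let \<open>s\<close> and \<open>v\<close> lie on the same side. If
      \<open>w\<close> joins them, \<open>w\<close> and \<open>v\<close> form a new pair; if not,
      \<open>s\<close> and \<open>w\<close> are separated although both are in \<open>A\<close>, and
      there is slack.\<close>
    moreover have "pairs A + 2 \<le> pairs S + pairs (insert v U - S)"
      if "S \<subseteq> insert v U" "(s \<in> S) = (v \<in> S)" for S
      using that(1)
    proof (rule cases_S)
      assume S: "S \<subseteq> U"
      then show ?thesis using mono_v2'[OF S] that(2) notin[OF S] B by blast
    next
      fix T assume S: "T \<subseteq> U" "S = insert v T"
      then show ?thesis using mono_v2[OF S(1)] that(2) vU(3) B by blast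
    qed
    ultimately show ?thesis
      using A'U indep' vU(2) unfolding bounds_def end_bounds_def A' by auto
  next
    case A
    then have A': "A' = insert v A" unfolding A'_def by simp
    have "{u \<in> A. N v u} = {}" using nb A AU by auto
    then have pA: "pairs (insert v A) = pairs A"
      using pairs_insert[OF fin[OF AU] vU(2)] by (metis add_0_right card.empty mult_0_right)
    \<comment> \<open>The new vertex of \<open>A'\<close> comes without a new pair, so relative to
      the old \<open>A\<close> a defect of 2 is allowed.\<close>
    have "2 * card S + pairs A \<le> 2 * card A + pairs S + 2" if "S \<subseteq> insert v U" for S
      using that by (rule cases_S) (use phi phi_v' in \<open>auto intro: le_SucI\<close>)
    moreover have "pairs A \<le> pairs S + pairs (insert v U - S)" if "S \<subseteq> insert v U" for S
      using that by (rule cases_S) (use mono_v in blast)+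
    moreover have "2 * card S + pairs A \<le> 2 * card A + pairs S"
      if "S \<subseteq> insert v U" "v \<notin> S" for S
      using that(1) by (rule cases_S) (use phi that in auto)
    moreover have "2 * card S + pairs A \<le> 2 * card A + pairs S"
      if "S \<subseteq> insert v U" "s \<notin> S" for S
      using that(1) by (rule cases_S) (use phi phi_v that in auto)
    moreover have "pairs A + 2 \<le> pairs S + pairs (insert v U - S)"
      if "S \<subseteq> insert v U" "(s \<in> S) \<noteq> (v \<in> S)" for S
      using that(1)
    proof (rule cases_S)
      assume S: "S \<subseteq> U"
      then show ?thesis using mono_v2'[OF S] that(2) notin[OF S] A by blast
    next
      fix T assume S: "T \<subseteq> U" "S = insert v T"
      then show ?thesis using mono_v2[OF S(1)] that(2) vU(3) A by blast
    qed
    ultimately show ?thesis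
      using A'U indep' unfolding bounds_def end_bounds_def A' by (auto simp: pA cA)
  next
    case close
    then have A': "A' = insert v A" unfolding A'_def by simp
    have "{u \<in> A. N v u} = {s}" using nb close AU sA by auto
    then have pA: "pairs (insert v A) = pairs A + 2"
      using pairs_insert[OF fin[OF AU] vU(2)] by simp
    have "2 * card S + pairs A \<le> 2 * card A + pairs S" if "S \<subseteq> insert v U" for S
      using that by (rule cases_S) (use close phi phi_v in auto)
    \<comment> \<open>An odd cycle closes, so the gain of 2 is required of every set. As
      \<open>w\<close> is not in \<open>A\<close>, there is slack if \<open>s\<close> and
      \<open>w\<close> lie on the same side; if they are separated, \<open>v\<close> shares its side
      with one of them, and both are its non-neighbours.\<close>
    moreover have "pairs A + 2 \<le> pairs S + pairs (insert v U - S)" if "S \<subseteq> insert v U" for S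
      using that
    proof (rule cases_S)
      assume S: "S \<subseteq> U"
      then show ?thesis using mono_v2'[OF S] close by blast
    next
      fix T assume S: "T \<subseteq> U" "S = insert v T"
      then show ?thesis using mono_v2[OF S(1)] close by blast
    qed
    moreover have "saturated (insert v U) v"
      using no_third_neighbour[of v s w] vw close sA v sU wU UV unfolding saturated_def by blast
    ultimately show ?thesis
      using A'U indep' unfolding bounds_def A' by (auto simp: pA cA)
  qed
  then show "bounds (insert v U) A'"
    and "saturated (insert v U) v \<or> end_bounds (insert v U) A' s v" by auto
qed

section \<open>Comparison with arbitrary two-part partitions\<close>

text \<open>Let S be the larger part. If S is no larger than \<open>A\<close>, all denominators can
  be replaced by |S|, and m(A) \<le> m(S) + m(T) suffices. If S is larger than \<open>A\<close>, its
  own quotient suffices: S has at least |S| - |A| more non-edges than \<open>A\<close>, and m(A) /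
  |A| is at most 1.\<close>

lemma two_part_bound:
  assumes b: "bounds V A" and S: "S \<noteq> {}" "T \<noteq> {}" "S \<union> T = V" "S \<inter> T = {}"
  shows "real (pairs A) / real (card A) \<le>
    real (pairs S) / real (card S) + real (pairs T) / real (card T)"
  using S
proof (induction "card T" "card S" arbitrary: S T rule: linorder_wlog)
  case le
  have fin: "finite S" "finite T" "S \<subseteq> V" "T \<subseteq> V" "T = V - S"
    using le finite_V by (auto intro: finite_subset)
  then have pos: "0 < card S" "0 < card T"
    using le by (auto simp: card_gt_0_iff)
  have phi: "2 * card S + pairs A \<le> 2 * card A + pairs S" and mono: "pairs A \<le> pairs S + pairs T"
    using b fin unfolding bounds_def by auto
  have AV: "A \<subseteq> V" using b unfolding bounds_def by auto
  show ?case
  proof (cases "card S \<le> card A")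
    case True
    have "real (pairs A) / real (card A) \<le> real (pairs A) / real (card S)"
      using True pos by (intro divide_left_mono) auto
    also have "\<dots> \<le> real (pairs S + pairs T) / real (card S)"
      using mono by (intro divide_right_mono) auto
    also have "\<dots> \<le> real (pairs S) / real (card S) + real (pairs T) / real (card T)"
      using le(1) pos by (simp add: add_divide_distrib divide_left_mono)
    finally show ?thesis .
  next
    case False
    have "pairs A \<le> 2 * card A" using pairs_le_twice_card[OF AV] .
    have "real (pairs A) / real (card A) \<le> real (pairs S) / real (card S)"
    \<comment> \<open>For \<open>card A = 0\<close> the left-hand quotient is 0 by the convention on
      division.\<close>
    proof (cases "card A = 0")
      case False
      \<comment> \<open>Expanded, this says that raising the denominator from |A| to |S| and the
        numerator by twice the difference does not lower a quotient that is at most 2.\<close>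
      have "0 \<le> (real (card S) - real (card A)) * (2 * real (card A) - real (pairs A))"
        using \<open>\<not> card S \<le> card A\<close> \<open>pairs A \<le> 2 * card A\<close> by (intro mult_nonneg_nonneg) linarith+
      then have "real (pairs A) * real (card S) \<le>
          (2 * real (card S) + real (pairs A) - 2 * real (card A)) * real (card A)"
        by (simp add: algebra_simps)
      also have "\<dots> \<le> real (pairs S) * real (card A)"
        using phi by (intro mult_right_mono) linarith+
      finally show ?thesis
        using False pos by (simp add: field_simps)
    qed simp
    then show ?thesis by (simp add: add_increasing2)
  qed
next
  case sym
  then show ?case by (metis Int_commute Un_commute add.commute)
qed

section \<open>States of the greedy colouring\<close>

text \<open>The start \<open>s\<close> is quantified because the algorithm remembers only
  \<open>w\<close>. The clause \<open>end_bounds\<close> is demanded only of walks that can go on,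
  since it does not survive the closing of an odd cycle.\<close>

definition greedy_state :: "'a set \<Rightarrow> 'a set \<Rightarrow> 'a \<Rightarrow> bool" where
  "greedy_state U A w \<longleftrightarrow> U = {} \<and> A = {} \<or>
    (\<exists>s\<in>A. walk U s w \<and> bounds U A \<and> (saturated U w \<or> end_bounds U A s w))"

lemma greedy_state_extend:
  assumes "greedy_state U A w" "w \<in> U" "v \<in> V - U" "N w v"
  shows "greedy_state (insert v U) (if w \<in> A then A else insert v A) v"
proof -
  have "\<not> saturated U w" using assms unfolding saturated_def by auto
  then obtain s where s: "s \<in> A" "walk U s w" "bounds U A" "end_bounds U A s w"
    using assms unfolding greedy_state_def by auto
  show ?thesis
    using walk_extend[OF s(2) assms(3,4)] bounds_extend[OF s(2,3,4,1) assms(3,4)] s(1)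
    unfolding greedy_state_def by (metis insertCI)
qed

text \<open>If \<open>w\<close> is stuck, so is \<open>s\<close>, and then all of \<open>U\<close>
  is saturated: the components met so far are finished, and a new walk does not interact with
  them.\<close>

lemma greedy_state_start:
  assumes st: "greedy_state U A w" and w: "U = {} \<or> saturated U w" and v: "v \<in> V - U"
    and deg: "card {u \<in> V. N v u} \<le> 1 \<or> (\<forall>u\<in>V - U. 2 \<le> card {v \<in> V. N u v})"
  shows "greedy_state (insert v U) (insert v A) v"
proof -
  have b: "bounds U A"
    using st unfolding greedy_state_def bounds_def by auto
  have sat: "\<forall>u\<in>U. saturated U u"
    using st w unfolding greedy_state_def walk_def by blast
  have "U \<subseteq> V" using b unfolding bounds_def by simp
  then show ?thesis
    using walk_start[OF _ sat v deg] bounds_start[OF b sat v]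
    unfolding greedy_state_def by blast
qed

lemma greedy_state_bounds:
  assumes "greedy_state U A w"
  shows "bounds U A"
  using assms unfolding greedy_state_def bounds_def by auto

end

section \<open>Optimal partitions\<close>

locale near_complete_graph = two_sparse V N
  for V :: "'a set" and N and E :: "'a set set" +
  assumes simple: "simple_graph V E"
    and N_eq: "N u v \<longleftrightarrow> u \<noteq> v \<and> {u, v} \<notin> E"
begin

text \<open>The square \<open>S \<times> S\<close> splits into adjacent pairs, non-adjacent pairs
  and the diagonal, and every edge gives two ordered pairs.\<close>

lemma card_edges_twice:
  assumes "S \<subseteq> V"
  shows "2 * card {e \<in> E. e \<subseteq> S} + pairs S + card S = card S * card S"
proof -
  have fin: "finite S" using assms finite_V finite_subset by blast
  let ?D = "{(u, v). u \<in> S \<and> v \<in> S \<and> {u, v} \<in> E}"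
  have two: "card e = 2" if "e \<in> E" for e
    using simple that unfolding simple_graph_def by auto
  have finD: "finite ?D"
    by (rule finite_subset[of _ "S \<times> S"]) (use fin in auto)
  have fib: "card {p \<in> ?D. {fst p, snd p} = e} = 2" if e: "e \<in> {e \<in> E. e \<subseteq> S}" for e
  proof -
    obtain x y where xy: "e = {x, y}" "x \<noteq> y"
      using two[of e] e unfolding card_2_iff by auto
    then have "{p \<in> ?D. {fst p, snd p} = e} = {(x, y), (y, x)}"
      using e by (auto simp: doubleton_eq_iff insert_commute)
    then show ?thesis using xy by simp
  qed
  have img: "(\<lambda>p. {fst p, snd p}) ` ?D = {e \<in> E. e \<subseteq> S}"
  proof (intro equalityI subsetI)
    fix e assume e: "e \<in> {e \<in> E. e \<subseteq> S}"
    then obtain x y where "e = {x, y}"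
      using two[of e] unfolding card_2_iff by auto
    then show "e \<in> (\<lambda>p. {fst p, snd p}) ` ?D"
      using e by (intro image_eqI[of _ _ "(x, y)"]) auto
  qed auto
  have "card ?D = (\<Sum>e\<in>{e \<in> E. e \<subseteq> S}. card {p \<in> ?D. {fst p, snd p} = e})"
    using sum.image_gen[OF finD, of "\<lambda>_. 1::nat" "\<lambda>p. {fst p, snd p}"] img by simp
  then have D: "card ?D = 2 * card {e \<in> E. e \<subseteq> S}"
    using fib by simp
  have dg: "card ((\<lambda>u. (u, u)) ` S) = card S"
    by (simp add: card_image inj_on_def)
  let ?C = "{(u, v). u \<in> S \<and> v \<in> S \<and> u \<noteq> v \<and> {u, v} \<notin> E}"
  have finC: "finite ?C"
    by (rule finite_subset[of _ "S \<times> S"]) (use fin in auto)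
  have loop: "{u, u} \<notin> E" for u
    using two[of "{u, u}"] by auto
  have "S \<times> S = ?D \<union> ?C \<union> (\<lambda>u. (u, u)) ` S"
    by auto
  then have "card (S \<times> S) = card (?D \<union> ?C \<union> (\<lambda>u. (u, u)) ` S)"
    by simp
  also have "\<dots> = card (?D \<union> ?C) + card S"
    using loop fin finC finD dg by (subst card_Un_disjoint) auto
  also have "card (?D \<union> ?C) = card ?D + card ?C"
    using finC finD by (subst card_Un_disjoint) auto
  finally show ?thesis
    using D by (simp add: pairs_def N_eq card_cartesian_product)
qed

lemma density_eq:
  assumes "S \<subseteq> V" "S \<noteq> {}"
  shows "density E S = (real (card S) - 1 - real (pairs S) / real (card S)) / 2"
proof -
  have "card S \<noteq> 0"
    using assms finite_V finite_subset by fastforce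
  have "real (2 * card {e \<in> E. e \<subseteq> S} + pairs S + card S) = real (card S * card S)"
    using card_edges_twice[OF assms(1)] by simp
  then have "2 * real (card {e \<in> E. e \<subseteq> S}) = real (card S) * real (card S) - real (pairs S) - real (card S)"
    by simp
  then have "real (card {e \<in> E. e \<subseteq> S}) = (real (card S) * real (card S) - real (pairs S) - real (card S)) / 2"
    by simp
  then show ?thesis
    using \<open>card S \<noteq> 0\<close> by (simp add: density_def field_simps)
qed

lemma partition_density_eq:
  assumes "partition_on V Q"
  shows "partition_density E Q =
    (real (card V) - real (card Q) - (\<Sum>S\<in>Q. real (pairs S) / real (card S))) / 2"
proof -
  have sub: "S \<subseteq> V" "S \<noteq> {}" if "S \<in> Q" for S
    using assms that unfolding partition_on_def by auto
  have "card V = (\<Sum>S\<in>Q. card S)"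
    using assms finite_V sub finite_subset unfolding partition_on_def
    by (metis card_Union_disjoint disjoint_def disjnt_def pairwise_def)
  then have n: "real (card V) = (\<Sum>S\<in>Q. real (card S))"
    by simp
  have "partition_density E Q = (\<Sum>S\<in>Q. (real (card S) - 1 - real (pairs S) / real (card S)) / 2)"
    unfolding partition_density_def by (rule sum.cong) (use sub density_eq in auto)
  also have "\<dots> = (real (card V) - real (card Q) - (\<Sum>S\<in>Q. real (pairs S) / real (card S))) / 2"
    by (simp add: n sum_subtractf sum_divide_distrib[symmetric])
  finally show ?thesis .
qed

lemma partition_density_upper:
  assumes b: "bounds V A" and Q: "partition_on V Q" and ne: "V \<noteq> {}"
  shows "partition_density E Q \<le>
    max (partition_density E {V}) ((real (card V) - 2 - real (pairs A) / real (card A)) / 2)"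
proof -
  have finQ: "finite Q" using Q finite_V finite_elements by blast
  have UQ: "\<Union>Q = V" using Q unfolding partition_on_def by auto
  then have "Q \<noteq> {}" using ne by auto
  then have "card Q \<noteq> 0" using finQ by simp
  then consider "card Q = 1" | "card Q = 2" | "3 \<le> card Q" by linarith
  then show ?thesis
  proof cases
    case 1
    then obtain S where "Q = {S}" by (auto simp: card_1_singleton_iff)
    then show ?thesis using UQ by simp
  next
    case 2
    then obtain S T where ST: "Q = {S, T}" "S \<noteq> T" by (auto simp: card_2_iff)
    then have "S \<noteq> {}" "T \<noteq> {}" "S \<union> T = V" "S \<inter> T = {}"
      using Q unfolding partition_on_def disjoint_def by auto
    then have "real (pairs A) / real (card A) \<le> (\<Sum>S\<in>Q. real (pairs S) / real (card S))"
      using two_part_bound[OF b] ST by simp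
    then show ?thesis
      unfolding partition_density_eq[OF Q] by (intro max.coboundedI2 divide_right_mono) (simp_all add: 2)
  next
    case 3
    \<comment> \<open>Three parts cost at least 3/2, whereas a single part costs 1/2 and at most 1
      for its non-edges.\<close>
    have "0 \<le> (\<Sum>S\<in>Q. real (pairs S) / real (card S))"
      by (rule sum_nonneg) auto
    moreover have "real (pairs V) / real (card V) \<le> 2"
      using pairs_le_twice_card[of V] ne finite_V by (auto simp: divide_le_eq card_gt_0_iff)
    moreover have "partition_on V {V}" using ne by (simp add: partition_on_space)
    ultimately have "partition_density E Q \<le> partition_density E {V}"
      using 3 partition_density_eq[OF Q] partition_density_eq[of "{V}"] by simp
    then show ?thesis by simp
  qed
qed

text \<open>The condition is \<open>1 + pairs A / card A < pairs V / card V\<close>, the comparison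
  of the two candidates, with denominators cleared so that a machine on natural numbers can test
  it.\<close>

lemma optimal_partition:
  assumes b: "bounds V A" and ne: "V \<noteq> {}"
  shows "if card V * (card A + pairs A) < pairs V * card A
    then A \<noteq> {} \<and> A \<noteq> V \<and> max_dense_partition V E {A, V - A}
    else max_dense_partition V E {V}"
proof -
  have AV: "A \<subseteq> V" using b unfolding bounds_def by auto
  obtain v where "v \<in> V" using ne by auto
  \<comment> \<open>Comparing \<open>A\<close> with a single vertex shows that \<open>A\<close> is
    nonempty.\<close>
  then have "2 * card {v} + pairs A \<le> 2 * card A + pairs {v}"
    using b unfolding bounds_def by blast
  moreover have "pairs {v} = 0"
    using pairs_insert[of "{}" v] by simp
  ultimately have A0: "0 < card A" by simp
  have V0: "0 < card V" using ne finite_V by (simp add: card_gt_0_iff)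
  have pV: "partition_on V {V}" using ne by (simp add: partition_on_space)
  have dV: "partition_density E {V} = (real (card V) - 1 - real (pairs V) / real (card V)) / 2"
    using partition_density_eq[OF pV] by simp
  show ?thesis
  proof (cases "card V * (card A + pairs A) < pairs V * card A")
    case True
    have "pairs (V - A) = 0"
      using b finite_V unfolding bounds_def pairs_def by (auto intro: arg_cong[of _ "{}" card, simplified])
    have "A \<noteq> V"
      using True V0 by auto
    have part: "partition_on V {A, V - A}"
      using AV A0 \<open>A \<noteq> V\<close> by (auto simp: partition_on_def disjoint_def)
    have "real (card V * (card A + pairs A)) < real (pairs V * card A)"
      using True by (simp only: of_nat_less_iff)
    then have lt: "1 + real (pairs A) / real (card A) < real (pairs V) / real (card V)"
      using A0 V0 by (simp add: field_simps)
    \<comment> \<open>Otherwise the set \<open>{A, V - A}\<close> would have only one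
      element.\<close>
    have "A \<noteq> V - A" using A0 AV by (metis Diff_disjoint Int_absorb card.empty less_irrefl)
    then have "partition_density E {A, V - A} = (real (card V) - 2 - real (pairs A) / real (card A)) / 2"
      using partition_density_eq[OF part] \<open>pairs (V - A) = 0\<close> by simp
    then have "max_dense_partition V E {A, V - A}"
      unfolding max_dense_partition_def
      using part partition_density_upper[OF b _ ne] dV lt by fastforce
    then show ?thesis using True A0 \<open>A \<noteq> V\<close> by auto
  next
    case False
    then have "real (pairs V * card A) \<le> real (card V * (card A + pairs A))"
      by (simp only: of_nat_le_iff not_less)
    then have le: "real (pairs V) / real (card V) \<le> 1 + real (pairs A) / real (card A)"
      using A0 V0 by (simp add: field_simps)
    have "max_dense_partition V E {V}"
      unfolding max_dense_partition_def
      using pV partition_density_upper[OF b _ ne] dV le by fastforce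
    then show ?thesis using False by simp
  qed
qed

end

section \<open>Running programs\<close>

definition runs :: "com \<Rightarrow> store \<Rightarrow> nat \<Rightarrow> (store \<Rightarrow> bool) \<Rightarrow> bool" where
  "runs c s T Q \<longleftrightarrow> (\<exists>t s'. exec c s t s' \<and> t \<le> T \<and> Q s')"

lemma runs_mono:
  assumes "runs c s T Q" "T \<le> T'" "\<And>s'. Q s' \<Longrightarrow> Q' s'"
  shows "runs c s T' Q'"
  using assms unfolding runs_def by (meson le_trans)

lemma runs_Seq:
  assumes "runs c1 s T1 R" "\<And>s'. R s' \<Longrightarrow> runs c2 s' T2 Q"
  shows "runs (Seq c1 c2) s (T1 + T2) Q"
  using assms unfolding runs_def by (meson add_mono exec.Seq)

lemma runs_Cond:
  assumes "bval b s \<Longrightarrow> runs c1 s T Q" "\<not> bval b s \<Longrightarrow> runs c2 s T Q"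
  shows "runs (Cond b c1 c2) s (1 + T) Q"
  using assms unfolding runs_def
  by (cases "bval b s") (meson add_left_mono CondTrue CondFalse)+

fun loop_free :: "com \<Rightarrow> bool" where
  "loop_free (Seq c1 c2) \<longleftrightarrow> loop_free c1 \<and> loop_free c2"
| "loop_free (Cond b c1 c2) \<longleftrightarrow> loop_free c1 \<and> loop_free c2"
| "loop_free (While b c) \<longleftrightarrow> False"
| "loop_free _ \<longleftrightarrow> True"

text \<open>On loop-free commands execution is a function, so that loop bodies can be verified by
  simplification. The value on \<open>While\<close> is a dummy.\<close>

fun result :: "com \<Rightarrow> store \<Rightarrow> store" where
  "result (Assign x i a) s = s(x := (s x)(aval i s := aval a s))"
| "result (Seq c1 c2) s = result c2 (result c1 s)"
| "result (Cond b c1 c2) s = (if bval b s then result c1 s else result c2 s)"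
| "result _ s = s"

fun cost :: "com \<Rightarrow> nat" where
  "cost (Seq c1 c2) = cost c1 + cost c2"
| "cost (Cond b c1 c2) = 1 + max (cost c1) (cost c2)"
| "cost _ = 1"

lemma runs_result: "loop_free c \<Longrightarrow> runs c s (cost c) (\<lambda>s'. s' = result c s)"
proof (induction c arbitrary: s)
  case (Seq c1 c2)
  then have "runs (Seq c1 c2) s (cost c1 + cost c2) (\<lambda>s'. s' = result c2 (result c1 s))"
    by (intro runs_Seq[of _ _ _ "\<lambda>s'. s' = result c1 s"]) auto
  then show ?case by simp
next
  case (Cond b c1 c2)
  then have "runs (Cond b c1 c2) s (1 + max (cost c1) (cost c2)) (\<lambda>s'. s' = result (Cond b c1 c2) s)"
    by (intro runs_Cond) (auto intro: runs_mono[OF Cond.IH(1)] runs_mono[OF Cond.IH(2)])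
  then show ?case by simp
qed (auto simp: runs_def intro: exec.intros)

lemma runs_loop_free:
  assumes "loop_free c" "cost c \<le> T" "Q (result c s)"
  shows "runs c s T Q"
  using runs_mono[OF runs_result] assms by metis

abbreviation var :: "vname \<Rightarrow> aexp" where
  "var x \<equiv> Entry x (Num 0)"

abbreviation set_var :: "vname \<Rightarrow> aexp \<Rightarrow> com" where
  "set_var x a \<equiv> Assign x (Num 0) a"

section \<open>Counting loops\<close>

definition For :: "vname \<Rightarrow> com \<Rightarrow> com" where
  "For i c = Seq (set_var i (Num 0))
    (While (Less (var i) (var ''n'')) (Seq c (set_var i (Plus (var i) (Num 1)))))"

text \<open>Each round takes one step for the test and one for the increment besides its body; the
  other 2 steps are the initialisation and the failing test. The invariant must determine the
  counter and \<open>n\<close>, as the test depends on both.\<close>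

lemma runs_For:
  assumes init: "I 0 (s(i := (s i)(0 := 0)))"
    and step: "\<And>k s. k < N \<Longrightarrow> I k s \<Longrightarrow>
      runs c s T (\<lambda>s'. s' i 0 = k \<and> I (Suc k) (s'(i := (s' i)(0 := Suc k))))"
    and I: "\<And>k s. I k s \<Longrightarrow> s i 0 = k \<and> s ''n'' 0 = N"
  shows "runs (For i c) s (2 + N * (T + 2)) (I N)"
proof -
  let ?W = "While (Less (var i) (var ''n'')) (Seq c (set_var i (Plus (var i) (Num 1))))"
  have W: "runs ?W s (1 + (N - k) * (T + 2)) (I N)" if "k \<le> N" "I k s" for k s
    using that
  proof (induction k arbitrary: s rule: inc_induct)
    case base
    then show ?case
      using I unfolding runs_def by (fastforce intro: WhileFalse)
  next
    case (step k)
    obtain t s' where s': "exec c s t s'" "t \<le> T" "s' i 0 = k"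
        "I (Suc k) (s'(i := (s' i)(0 := Suc k)))"
      using assms(2)[OF step(2,4)] unfolding runs_def by blast
    obtain t' s'' where s'': "exec ?W (s'(i := (s' i)(0 := Suc k))) t' s''"
        "t' \<le> 1 + (N - Suc k) * (T + 2)" "I N s''"
      using step(3)[OF s'(4)] unfolding runs_def by blast
    have "exec (set_var i (Plus (var i) (Num 1))) s' 1 (s'(i := (s' i)(0 := Suc k)))"
      using exec.Assign[of i "Num 0" "Plus (var i) (Num 1)" s'] s'(3) by simp
    then have "exec ?W s (1 + (t + 1) + t') s''"
      using s' s''(1) I[OF step(4)] step(2) by (intro WhileTrue exec.Seq) auto
    moreover have "N - k = Suc (N - Suc k)" using step(2) by simp
    then have "1 + (t + 1) + t' \<le> 1 + (N - k) * (T + 2)"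
      using s'(2) s''(2) by simp
    ultimately show ?case using s''(3) unfolding runs_def by blast
  qed
  have "runs (For i c) s (1 + (1 + (N - 0) * (T + 2))) (I N)"
    unfolding For_def
  proof (rule runs_Seq)
    show "runs (set_var i (Num 0)) s 1 (\<lambda>s'. s' = s(i := (s i)(0 := 0)))"
      by (rule runs_loop_free) auto
  qed (use W[OF _ init] in auto)
  then show ?thesis by simp
qed

section \<open>The program\<close>

text \<open>The array \<open>row\<close> tabulates where each row of the adjacency matrix begins in
  the input, because the machine cannot multiply.\<close>

abbreviation non_adj :: "aexp \<Rightarrow> aexp \<Rightarrow> bexp" where
  "non_adj u v \<equiv> Conj (Neg (Equal u v)) (Equal (Entry ''input'' (Plus (Entry ''row'' u) v)) (Num 0))"

definition row_step :: com where
  "row_step = Assign ''row'' (Plus (var ''i'') (Num 1)) (Plus (Entry ''row'' (var ''i'')) (var ''n''))"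

definition deg_step :: com where
  "deg_step = Cond (non_adj (var ''i'') (var ''j''))
        (Assign ''deg'' (var ''i'') (Plus (Entry ''deg'' (var ''i'')) (Num 1))) Skip"

text \<open>Row 0 begins at index 1, as index 0 of the input holds the number of vertices.\<close>

definition prepare :: com where
  "prepare = Seq (set_var ''n'' (var ''input'')) (Seq (set_var ''row'' (Num 1))
    (For ''i'' (Seq row_step (For ''j'' deg_step))))"

text \<open>
  \<open>output\<close> holds the colours (0 for a vertex that has not been reached, 1 and 2 for the two parts) and
  \<open>w\<close> the end of the current walk. The vertex \<open>b\<close> to be coloured next has the largest
  \<open>rank\<close>: 3 for a continuation of the walk, 2 for a vertex with at most one non-neighbour.
\<close>

definition select_step :: com where
  "select_step = Cond (Equal (Entry ''output'' (var ''j'')) (Num 0))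
      (Cond (Conj (Neg (Equal (Entry ''output'' (var ''w'')) (Num 0))) (non_adj (var ''w'') (var ''j'')))
        (Seq (set_var ''rank'' (Num 3)) (set_var ''b'' (var ''j'')))
        (Cond (Conj (Less (var ''rank'') (Num 2)) (Less (Entry ''deg'' (var ''j'')) (Num 2)))
          (Seq (set_var ''rank'' (Num 2)) (set_var ''b'' (var ''j'')))
          (Cond (Less (var ''rank'') (Num 1))
            (Seq (set_var ''rank'' (Num 1)) (set_var ''b'' (var ''j'')))
            Skip)))
      Skip"

definition select :: com where
  "select = Seq (set_var ''rank'' (Num 0))
    (For ''j'' select_step)"

definition colour_step :: com where
  "colour_step = Seq
    (Cond (Equal (var ''rank'') (Num 3))
      (Assign ''output'' (var ''b'') (Minus (Num 3) (Entry ''output'' (var ''w''))))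
      (Assign ''output'' (var ''b'') (Num 1)))
    (set_var ''w'' (var ''b''))"

definition colour :: com where
  "colour = For ''i'' (Seq select colour_step)"

text \<open>\<open>x\<close> and \<open>y\<close> are the two sides of the inequality in \<open>optimal_partition\<close>.\<close>

definition count_step :: com where
  "count_step = Cond (non_adj (var ''i'') (var ''j''))
        (Seq (set_var ''x'' (Plus (var ''x'') (var ''a'')))
          (Cond (Equal (Entry ''output'' (var ''i'')) (Entry ''output'' (var ''j'')))
            (set_var ''y'' (Plus (var ''y'') (var ''n''))) Skip))
        Skip"

text \<open>Products arise by repeated addition: \<open>x\<close> receives \<open>a\<close> for
  every ordered non-edge, and \<open>y\<close> receives \<open>a\<close> for every vertex and
  \<open>n\<close> for every ordered non-edge with equally coloured ends.\<close>

definition count :: com where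
  "count = Seq
    (For ''i'' (Cond (Equal (Entry ''output'' (var ''i'')) (Num 1))
      (set_var ''a'' (Plus (var ''a'') (Num 1))) Skip))
    (For ''i'' (Seq (set_var ''y'' (Plus (var ''y'') (var ''a'')))
      (For ''j'' count_step)))"

definition finish :: com where
  "finish = Seq
    (Cond (Less (var ''y'') (var ''x'')) Skip (For ''i'' (Assign ''output'' (var ''i'') (Num 0))))
    (set_var ''output_length'' (var ''n''))"

definition solver :: com where
  "solver = Seq prepare (Seq colour (Seq count finish))"

lemma card_filter_Suc:
  "card {v \<in> {..<Suc k}. P v} = card {v \<in> {..<k}. P v} + (if P k then 1 else 0)"
proof -
  have "{v \<in> {..<Suc k}. P v} = (if P k then insert k {v \<in> {..<k}. P v} else {v \<in> {..<k}. P v})"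
    by (auto simp: less_Suc_eq)
  then show ?thesis by simp
qed

text \<open>Turns what a double loop accumulates into a product with a number of pairs.\<close>

lemma sum_if_card:
  fixes c n m :: nat
  shows "(\<Sum>u<n. \<Sum>v<m. if P u v then c else 0) = card {(u, v). u < n \<and> v < m \<and> P u v} * c"
proof -
  have "(\<Sum>u<n. \<Sum>v<m. if P u v then c else 0) =
      (\<Sum>p\<in>{..<n} \<times> {..<m}. if P (fst p) (snd p) then c else 0)"
    by (simp add: sum.cartesian_product case_prod_unfold)
  also have "\<dots> = (\<Sum>p\<in>{p \<in> {..<n} \<times> {..<m}. P (fst p) (snd p)}. c)"
    by (rule sum.inter_filter[symmetric]) simp
  also have "{p \<in> {..<n} \<times> {..<m}. P (fst p) (snd p)} = {(u, v). u < n \<and> v < m \<and> P u v}"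
    by auto
  finally show ?thesis by simp
qed

section \<open>Correctness and running time of the program\<close>

locale machine_graph = near_complete_graph "{..<n}" N E
  for n :: nat and N and E :: "nat set set" +
  assumes n_pos: "1 \<le> n"
begin

definition deg :: "nat \<Rightarrow> nat" where
  "deg u = card {v \<in> {..<n}. N u v}"

definition has_graph :: "store \<Rightarrow> bool" where
  "has_graph s \<longleftrightarrow> s ''n'' 0 = n \<and>
    (\<forall>u<n. \<forall>v<n. s ''input'' (s ''row'' u + v) = 0 \<longleftrightarrow> {u, v} \<notin> E)"

definition ready :: "store \<Rightarrow> bool" where
  "ready s \<longleftrightarrow> has_graph s \<and> (\<forall>u<n. s ''deg'' u = deg u) \<and>
    s ''a'' 0 = 0 \<and> s ''x'' 0 = 0 \<and> s ''y'' 0 = 0"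

abbreviation start :: store where
  "start \<equiv> input_store (encode_graph (n, E))"

lemma length_encode: "length (encode_graph (n, E)) = Suc (n * n)"
  by (simp add: encode_graph_def)

lemma index_less:
  assumes "u < n" "v < (n::nat)"
  shows "u * n + v < n * n"
proof -
  have "u * n + v < Suc u * n" using assms by simp
  also have "\<dots> \<le> n * n" using assms by (intro mult_le_mono1) simp
  finally show ?thesis .
qed

lemma start_input:
  assumes "u < n" "v < n"
  shows "start ''input'' (Suc (u * n + v)) = 0 \<longleftrightarrow> {u, v} \<notin> E"
  using index_less[OF assms] assms
  by (simp add: input_store_def length_encode) (simp add: encode_graph_def)

lemma runs_prepare:
  "runs prepare start (4 + n * (5 + n * 4))
    (\<lambda>s. ready s \<and> s ''output'' = (\<lambda>_. 0) \<and> s ''w'' 0 = 0)"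
proof -
  define base where "base s \<longleftrightarrow> s ''n'' 0 = n \<and> s ''input'' = start ''input'' \<and> s ''a'' 0 = 0 \<and>
    s ''x'' 0 = 0 \<and> s ''y'' 0 = 0 \<and> s ''output'' = (\<lambda>_. 0) \<and> s ''w'' 0 = 0" for s :: store
  define I where "I k s \<longleftrightarrow> base s \<and> s ''i'' 0 = k \<and> (\<forall>u\<le>k. s ''row'' u = Suc (u * n)) \<and>
    (\<forall>u. s ''deg'' u = (if u < k then deg u else 0))" for k and s :: store
  define J where "J k l s \<longleftrightarrow> base s \<and> s ''i'' 0 = k \<and> (\<forall>u\<le>Suc k. s ''row'' u = Suc (u * n)) \<and>
    s ''j'' 0 = l \<and>
    (\<forall>u. s ''deg'' u = (if u < k then deg u else if u = k then card {v \<in> {..<l}. N k v} else 0))"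
    for k l and s :: store
  have inner: "runs (For ''j'' deg_step) s
      (2 + n * (2 + 2)) (J k n)"
    if k: "k < n" and s: "J k 0 (s(''j'' := (s ''j'')(0 := 0)))" for k s
  proof (rule runs_For[where I = "J k", OF s])
    fix l s assume l: "l < n" and J: "J k l s"
    then have e: "s ''input'' (s ''row'' k + l) = 0 \<longleftrightarrow> {k, l} \<notin> E"
      using start_input[OF k l] k unfolding J_def base_def by simp
    have c: "card {v \<in> {..<Suc l}. N k v} =
        card {v \<in> {..<l}. N k v} + (if k \<noteq> l \<and> {k, l} \<notin> E then 1 else 0)"
      by (simp only: card_filter_Suc N_eq[of k l])
    show "runs deg_step s 2
        (\<lambda>s'. s' ''j'' 0 = l \<and> J k (Suc l) (s'(''j'' := (s' ''j'')(0 := Suc l))))"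
      by (rule runs_loop_free)
        (use J e c in \<open>auto simp: J_def base_def deg_step_def\<close>)
  qed (auto simp: J_def base_def)
  have outer: "runs (For ''i'' (Seq row_step (For ''j'' deg_step))) s
      (2 + n * ((1 + (2 + n * (2 + 2))) + 2)) (I n)"
    if s: "I 0 (s(''i'' := (s ''i'')(0 := 0)))" for s
  proof (rule runs_For[where I = I, OF s])
    fix k s assume k: "k < n" and I: "I k s"
    show "runs (Seq row_step (For ''j'' deg_step)) s
      (1 + (2 + n * (2 + 2))) (\<lambda>s'. s' ''i'' 0 = k \<and> I (Suc k) (s'(''i'' := (s' ''i'')(0 := Suc k))))"
    proof (rule runs_Seq)
      show "runs row_step s 1
          (\<lambda>s. J k 0 (s(''j'' := (s ''j'')(0 := 0))))"
        by (rule runs_loop_free) (use I in \<open>auto simp: I_def J_def base_def row_step_def\<close>)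
    next
      fix s assume J: "J k 0 (s(''j'' := (s ''j'')(0 := 0)))"
      show "runs (For ''j'' deg_step) s
        (2 + n * (2 + 2)) (\<lambda>s'. s' ''i'' 0 = k \<and> I (Suc k) (s'(''i'' := (s' ''i'')(0 := Suc k))))"
        by (rule runs_mono[OF inner[OF k J]]) (auto simp: I_def J_def base_def deg_def less_Suc_eq)
    qed
  qed (auto simp: I_def base_def)
  have fin: "ready s \<and> s ''output'' = (\<lambda>_. 0) \<and> s ''w'' 0 = 0" if "I n s" for s
    using that start_input unfolding I_def base_def ready_def has_graph_def by simp
  have st0: "start ''input'' 0 = n"
    by (simp add: input_store_def encode_graph_def)
  have "runs prepare start (1 + (1 + (2 + n * ((1 + (2 + n * (2 + 2))) + 2)))) (I n)"
    unfolding prepare_def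
  proof (rule runs_Seq)
    show "runs (set_var ''n'' (var ''input'')) start 1
        (\<lambda>s. s = start(''n'' := (start ''n'')(0 := n)))"
      by (rule runs_loop_free) (use st0 in auto)
  next
    fix s assume s: "s = start(''n'' := (start ''n'')(0 := n))"
    show "runs (Seq (set_var ''row'' (Num 1)) (For ''i'' (Seq row_step (For ''j'' deg_step)))) s
        (1 + (2 + n * ((1 + (2 + n * (2 + 2))) + 2))) (I n)"
    proof (rule runs_Seq[OF _ outer])
      show "runs (set_var ''row'' (Num 1)) s 1 (\<lambda>s. I 0 (s(''i'' := (s ''i'')(0 := 0))))"
        by (rule runs_loop_free) (use s in \<open>auto simp: I_def base_def input_store_def\<close>)
    qed
  qed
  then show ?thesis
    by (rule runs_mono) (use fin in \<open>auto simp: algebra_simps\<close>)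
qed

abbreviation coloured :: "store \<Rightarrow> nat set" where
  "coloured s \<equiv> {v \<in> {..<n}. s ''output'' v \<noteq> 0}"

abbreviation part_1 :: "store \<Rightarrow> nat set" where
  "part_1 s \<equiv> {v \<in> {..<n}. s ''output'' v = 1}"

text \<open>The guard on the colour of \<open>w\<close> matters at the beginning, when
  \<open>w\<close> has the default value 0 and there is no walk yet.\<close>

definition rank :: "store \<Rightarrow> nat \<Rightarrow> nat" where
  "rank s v = (if s ''output'' v \<noteq> 0 then 0
     else if s ''output'' (s ''w'' 0) \<noteq> 0 \<and> N (s ''w'' 0) v then 3
     else if deg v < 2 then 2 else 1)"

text \<open>With \<open>l\<close> as loop counter this is the invariant of \<open>select\<close>. A
  stored rank 0 means that all vertices inspected so far are coloured.\<close>

definition selected :: "store \<Rightarrow> nat \<Rightarrow> store \<Rightarrow> bool" where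
  "selected s l s' \<longleftrightarrow> (\<forall>x. x \<notin> {''rank'', ''b'', ''j''} \<longrightarrow> s' x = s x) \<and>
    (\<forall>v<l. rank s v \<le> s' ''rank'' 0) \<and>
    (s' ''rank'' 0 \<noteq> 0 \<longrightarrow> s' ''b'' 0 < l \<and> rank s (s' ''b'' 0) = s' ''rank'' 0)"

lemma runs_select:
  assumes s: "ready s" and w: "s ''w'' 0 < n"
  shows "runs select s (1 + (2 + n * (6 + 2))) (selected s n)"
proof -
  define I where "I l s' \<longleftrightarrow> selected s l s' \<and> s' ''j'' 0 = l" for l s'
  show ?thesis
    unfolding select_def
  proof (rule runs_Seq)
    show "runs (set_var ''rank'' (Num 0)) s 1 (\<lambda>s'. I 0 (s'(''j'' := (s' ''j'')(0 := 0))))"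
      by (rule runs_loop_free) (auto simp: I_def selected_def)
  next
    fix s' assume "I 0 (s'(''j'' := (s' ''j'')(0 := 0)))"
    then have "runs (For ''j'' select_step) s' (2 + n * (6 + 2)) (I n)"
    proof (rule runs_For[where I = I])
      fix l s' assume l: "l < n" and I: "I l s'"
      have frame: "s' x = s x" if "x \<notin> {''rank'', ''b'', ''j''}" for x
        using I that unfolding I_def selected_def by blast
      have eqs: "s' ''output'' = s ''output''" "s' ''w'' = s ''w''" "s' ''deg'' = s ''deg''"
          "s' ''input'' = s ''input''" "s' ''row'' = s ''row''"
        by (rule frame, simp)+
      have j: "s' ''j'' 0 = l" using I unfolding I_def by simp
      have e: "s ''input'' (s ''row'' (s ''w'' 0) + l) = 0 \<longleftrightarrow> {s ''w'' 0, l} \<notin> E" "s ''deg'' l = deg l"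
        using s w l unfolding ready_def has_graph_def by auto
      have r: "rank s l = (if s ''output'' l \<noteq> 0 then 0
         else if s ''output'' (s ''w'' 0) \<noteq> 0 \<and> s ''w'' 0 \<noteq> l \<and> {s ''w'' 0, l} \<notin> E then 3
         else if deg l < 2 then 2 else 1)"
        by (simp add: rank_def N_eq)
      have r3: "rank s v \<le> 3" for v by (simp add: rank_def)
      have old: "\<forall>v<l. rank s v \<le> s' ''rank'' 0"
          "s' ''rank'' 0 \<noteq> 0 \<longrightarrow> s' ''b'' 0 < l \<and> rank s (s' ''b'' 0) = s' ''rank'' 0"
        using I unfolding I_def selected_def by auto
      \<comment> \<open>The branch for rank 3 replaces the candidate without a comparison, which is
        sound because the stored rank never exceeds 3.\<close>
      have k3: "s' ''rank'' 0 \<le> 3"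
        using old(2) r3[of "s' ''b'' 0"] by fastforce
      show "runs select_step s' 6 (\<lambda>s''. s'' ''j'' 0 = l \<and> I (Suc l) (s''(''j'' := (s'' ''j'')(0 := Suc l))))"
      proof (rule runs_loop_free)
        let ?s = "result select_step s'"
        have "?s = s' \<and> rank s l \<le> s' ''rank'' 0 \<or>
            ?s = s'(''rank'' := (s' ''rank'')(0 := rank s l), ''b'' := (s' ''b'')(0 := l)) \<and>
              s' ''rank'' 0 \<le> rank s l \<and> rank s l \<noteq> 0"
          using k3 by (simp add: select_step_def r eqs j e)
        then show "?s ''j'' 0 = l \<and> I (Suc l) (?s(''j'' := (?s ''j'')(0 := Suc l)))"
        proof (elim disjE conjE)
          assume "?s = s'" "rank s l \<le> s' ''rank'' 0"
          then show ?thesis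
            using frame old j by (auto simp: I_def selected_def less_Suc_eq)
        next
          assume "?s = s'(''rank'' := (s' ''rank'')(0 := rank s l), ''b'' := (s' ''b'')(0 := l))"
            "s' ''rank'' 0 \<le> rank s l"
          then show ?thesis
            using frame old(1) j by (auto simp: I_def selected_def less_Suc_eq intro: order_trans)
        qed
      qed (simp_all add: select_step_def)
    next
      fix k s' assume "I k s'"
      then show "s' ''j'' 0 = k \<and> s' ''n'' 0 = n"
        using s unfolding I_def selected_def ready_def has_graph_def by simp
    qed
    then show "runs (For ''j'' select_step) s' (2 + n * (6 + 2)) (selected s n)"
      by (rule runs_mono) (auto simp: I_def)
  qed
qed

definition valid_colouring :: "store \<Rightarrow> bool" where
  "valid_colouring s \<longleftrightarrow> (\<forall>v. s ''output'' v \<le> 2) \<and>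
    greedy_state (coloured s) (part_1 s) (s ''w'' 0)"

text \<open>Rank 3 continues the walk. A smaller maximum means that \<open>w\<close> has no
  uncoloured non-neighbour, so that a new walk may start: at a vertex with at most one non-neighbour
  for rank 2, while rank 1 shows that no such vertex is left uncoloured.\<close>

lemma valid_colouring_step:
  assumes vc: "valid_colouring s" and w: "coloured s \<noteq> {} \<Longrightarrow> s ''output'' (s ''w'' 0) \<noteq> 0" "s ''w'' 0 < n"
    and sel: "selected s n s'" and ex: "\<exists>v<n. s ''output'' v = 0"
    and s'': "s'' ''output'' = (s ''output'')(s' ''b'' 0 :=
      if s' ''rank'' 0 = 3 then 3 - s ''output'' (s ''w'' 0) else 1)" "s'' ''w'' 0 = s' ''b'' 0"
  shows "valid_colouring s'' \<and> coloured s'' = insert (s' ''b'' 0) (coloured s) \<and>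
    s' ''b'' 0 \<in> {..<n} - coloured s \<and> s'' ''output'' (s' ''b'' 0) \<noteq> 0"
proof -
  define b where "b = s' ''b'' 0"
  define w where "w = s ''w'' 0"
  have le: "rank s v \<le> s' ''rank'' 0" if "v < n" for v
    using sel that unfolding selected_def by blast
  obtain v where v: "v < n" "s ''output'' v = 0" using ex by auto
  have "1 \<le> rank s v" using v by (simp add: rank_def)
  then have "s' ''rank'' 0 \<noteq> 0" using le[OF v(1)] by auto
  then have bn: "b < n" and rb: "rank s b = s' ''rank'' 0" "rank s b \<noteq> 0"
    using sel unfolding selected_def b_def by auto
  have ob: "s ''output'' b = 0" using rb(2) by (auto simp: rank_def split: if_splits)
  have gs: "greedy_state (coloured s) (part_1 s) w"
    using vc unfolding valid_colouring_def w_def by blast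
  have bU: "b \<in> {..<n} - coloured s" using bn ob by simp
  have o2: "s ''output'' u \<le> 2" for u using vc unfolding valid_colouring_def by blast
  define c where "c = (if rank s b = 3 then 3 - s ''output'' w else 1)"
  have c: "c \<noteq> 0" "c \<le> 2"
    using o2[of w] by (auto simp: c_def rank_def w_def split: if_splits)
  have out: "s'' ''output'' = (s ''output'')(b := c)"
    using s'' rb unfolding c_def b_def w_def by simp
  have U: "coloured s'' = insert b (coloured s)"
    using bn c by (auto simp: out)
  have "greedy_state (insert b (coloured s)) (part_1 s'') b"
  proof (cases "rank s b = 3")
    case True
    then have Nw: "s ''output'' w \<noteq> 0" "N w b"
      by (auto simp: rank_def w_def split: if_splits)
    have wU: "w \<in> coloured s" using Nw assms(3) by (simp add: w_def)
    \<comment> \<open>Subtraction from 3 swaps the colours, so \<open>b\<close> enters part 1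
      exactly when \<open>w\<close> is in part 2.\<close>
    have "part_1 s'' = (if w \<in> part_1 s then part_1 s else insert b (part_1 s))"
      using True wU o2[of w] ob bn by (auto simp: out c_def le_Suc_eq numeral_2_eq_2)
    then show ?thesis
      using greedy_state_extend[OF gs wU bU Nw(2)] by simp
  next
    case False
    then have P: "part_1 s'' = insert b (part_1 s)"
      using bn by (auto simp: out c_def)
    have not3: "rank s u \<noteq> 3" if "u < n" for u
      using le[OF that] rb False by (auto simp: rank_def split: if_splits)
    have n3: "\<not> N w u" if "u \<in> {..<n} - coloured s" "s ''output'' w \<noteq> 0" for u
    proof
      assume "N w u"
      then have "rank s u = 3" using that by (simp add: rank_def w_def)
      then show False using that not3 by blast
    qed
    have "coloured s = {} \<or> saturated (coloured s) w"
    proof (cases "coloured s = {}")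
      case False
      then show ?thesis
        using assms(2) n3 unfolding saturated_def w_def[symmetric] by blast
    qed simp
    moreover
    have "card {u \<in> {..<n}. N b u} \<le> 1 \<or> (\<forall>u\<in>{..<n} - coloured s. 2 \<le> card {v \<in> {..<n}. N u v})"
    proof (cases "rank s b = 2")
      case True
      then have "deg b < 2" by (auto simp: rank_def split: if_splits)
      then show ?thesis by (simp add: deg_def)
    next
      case False
      then have "rank s b = 1" using rb(2) \<open>rank s b \<noteq> 3\<close> by (auto simp: rank_def split: if_splits)
      then have "\<not> deg u < 2" if "u \<in> {..<n} - coloured s" for u
        using le[of u] that rb by (auto simp: rank_def split: if_splits)
      then show ?thesis by (auto simp: deg_def not_less)
    qed
    ultimately show ?thesis
      unfolding P using greedy_state_start[OF gs _ bU] by blast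
  qed
  then show ?thesis
    using U c o2 bU s''(2) unfolding valid_colouring_def b_def[symmetric] by (auto simp: out)
qed

text \<open>Every round colours exactly one new vertex, so an uncoloured one exists in each of the
  \<open>n\<close> rounds and none remains afterwards.\<close>

lemma runs_colour:
  assumes s: "ready s" "s ''output'' = (\<lambda>_. 0)" "s ''w'' 0 = 0"
  shows "runs colour s (2 + n * ((1 + (2 + n * (6 + 2)) + 3) + 2))
    (\<lambda>s. ready s \<and> valid_colouring s \<and> coloured s = {..<n})"
proof -
  define I where "I k s \<longleftrightarrow> ready s \<and> valid_colouring s \<and> s ''w'' 0 < n \<and>
    (coloured s \<noteq> {} \<longrightarrow> s ''output'' (s ''w'' 0) \<noteq> 0) \<and>
    card (coloured s) = k \<and> s ''i'' 0 = k" for k s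
  have I0: "I 0 (s(''i'' := (s ''i'')(0 := 0)))"
    using s n_pos
    by (auto simp: I_def ready_def has_graph_def valid_colouring_def greedy_state_def)
  have "runs colour s (2 + n * ((1 + (2 + n * (6 + 2)) + 3) + 2)) (I n)"
    unfolding colour_def
  proof (rule runs_For[where I = I, OF I0])
    fix k s assume k: "k < n" and I: "I k s"
    then have rs: "ready s" and wn: "s ''w'' 0 < n" unfolding I_def by auto
    show "runs (Seq select colour_step) s (1 + (2 + n * (6 + 2)) + 3)
      (\<lambda>s'. s' ''i'' 0 = k \<and> I (Suc k) (s'(''i'' := (s' ''i'')(0 := Suc k))))"
    proof (rule runs_Seq[OF runs_select[OF rs wn]])
      fix s' assume sel: "selected s n s'"
      have ex: "\<exists>v<n. s ''output'' v = 0"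
      proof (rule ccontr)
        assume "\<not> ?thesis"
        then have "coloured s = {..<n}" by auto
        then show False using I k unfolding I_def by simp
      qed
      have frame: "s' x = s x" if "x \<notin> {''rank'', ''b'', ''j''}" for x
        using sel that unfolding selected_def by blast
      have eqs: "s' ''output'' = s ''output''" "s' ''w'' = s ''w''" "s' ''deg'' = s ''deg''"
          "s' ''input'' = s ''input''" "s' ''row'' = s ''row''" "s' ''i'' = s ''i''"
          "s' ''n'' = s ''n''" "s' ''a'' = s ''a''" "s' ''x'' = s ''x''" "s' ''y'' = s ''y''"
        by (rule frame, simp)+
      show "runs colour_step s' 3
        (\<lambda>s'. s' ''i'' 0 = k \<and> I (Suc k) (s'(''i'' := (s' ''i'')(0 := Suc k))))"
      proof (rule runs_loop_free, goal_cases)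
        case 3
        define s1 where "s1 = result colour_step s'"
        define s2 where "s2 = s1(''i'' := (s1 ''i'')(0 := Suc k))"
        have s2: "s2 ''output'' = (s ''output'')(s' ''b'' 0 :=
            if s' ''rank'' 0 = 3 then 3 - s ''output'' (s ''w'' 0) else 1)" "s2 ''w'' 0 = s' ''b'' 0"
          by (simp_all add: s2_def s1_def colour_step_def eqs)
        have step: "valid_colouring s2 \<and> coloured s2 = insert (s' ''b'' 0) (coloured s) \<and>
            s' ''b'' 0 \<in> {..<n} - coloured s \<and> s2 ''output'' (s' ''b'' 0) \<noteq> 0"
          by (rule valid_colouring_step[OF _ _ wn sel ex s2]) (use I in \<open>auto simp: I_def\<close>)
        have "ready s2"
          using rs by (simp add: ready_def has_graph_def s2_def s1_def colour_step_def eqs)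
        moreover have "card (coloured s2) = Suc k"
          using step I by (simp add: I_def)
        moreover have "s1 ''i'' 0 = k" "s2 ''i'' 0 = Suc k"
          using I by (auto simp: s2_def s1_def colour_step_def eqs I_def)
        ultimately have "s1 ''i'' 0 = k \<and> I (Suc k) s2"
          using step s2(2) unfolding I_def by simp
        then show ?case unfolding s2_def s1_def .
      qed (simp_all add: colour_step_def)
    qed
  qed (auto simp: I_def ready_def has_graph_def)
  then show ?thesis
  proof (rule runs_mono)
    fix s assume "I n s"
    then show "ready s \<and> valid_colouring s \<and> coloured s = {..<n}"
      unfolding I_def by (metis (no_types, lifting) card_lessThan card_subset_eq finite_lessThan mem_Collect_eq subsetI)
  qed simp
qed

definition x_row :: "nat \<Rightarrow> nat \<Rightarrow> nat \<Rightarrow> nat" where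
  "x_row a l u = (\<Sum>v<l. if N u v then a else 0)"

definition y_row :: "(nat \<Rightarrow> nat) \<Rightarrow> nat \<Rightarrow> nat \<Rightarrow> nat" where
  "y_row f l u = (\<Sum>v<l. if N u v \<and> f u = f v then n else 0)"

lemma runs_count:
  assumes s: "ready s" and f: "s ''output'' = f"
  shows "runs count s ((2 + n * (2 + 2)) + (2 + n * ((1 + (2 + n * (4 + 2))) + 2)))
    (\<lambda>s. has_graph s \<and> s ''output'' = f \<and>
      s ''x'' 0 = (\<Sum>u<n. x_row (card {v \<in> {..<n}. f v = 1}) n u) \<and>
      s ''y'' 0 = (\<Sum>u<n. card {v \<in> {..<n}. f v = 1} + y_row f n u))"
proof -
  define a where "a = card {v \<in> {..<n}. f v = 1}"
  define base where "base s \<longleftrightarrow> has_graph s \<and> s ''output'' = f" for s :: store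
  define I where "I k s \<longleftrightarrow> base s \<and> s ''i'' 0 = k \<and> s ''a'' 0 = card {v \<in> {..<k}. f v = 1} \<and>
    s ''x'' 0 = 0 \<and> s ''y'' 0 = 0" for k s
  define J where "J k s \<longleftrightarrow> base s \<and> s ''i'' 0 = k \<and> s ''a'' 0 = a \<and>
    s ''x'' 0 = (\<Sum>u<k. x_row a n u) \<and> s ''y'' 0 = (\<Sum>u<k. a + y_row f n u)" for k s
  \<comment> \<open>The summand \<open>a\<close> of row \<open>k\<close> is already part of
    \<open>y\<close>, as it is added before the inner loop.\<close>
  define K where "K k l s \<longleftrightarrow> base s \<and> s ''i'' 0 = k \<and> s ''j'' 0 = l \<and> s ''a'' 0 = a \<and>
    s ''x'' 0 = (\<Sum>u<k. x_row a n u) + x_row a l k \<and>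
    s ''y'' 0 = (\<Sum>u<k. a + y_row f n u) + a + y_row f l k" for k l s
  have n: "s ''n'' 0 = n" if "base s" for s
    using that unfolding base_def has_graph_def by simp
  have base_upd: "base (s(x := g)) = base s"
    if "x \<notin> {''n'', ''input'', ''row'', ''output''}" for s x g
    using that by (auto simp: base_def has_graph_def)
  have first: "runs (For ''i'' (Cond (Equal (Entry ''output'' (var ''i'')) (Num 1))
      (set_var ''a'' (Plus (var ''a'') (Num 1))) Skip)) s (2 + n * (2 + 2)) (I n)"
  proof (rule runs_For[where I = I])
    show "I 0 (s(''i'' := (s ''i'')(0 := 0)))"
      using s f by (simp add: I_def base_upd) (simp add: base_def ready_def)
  next
    fix k s assume I: "I k s"
    then have "s ''output'' k = f k" unfolding I_def base_def by simp
    then show "runs (Cond (Equal (Entry ''output'' (var ''i'')) (Num 1))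
        (set_var ''a'' (Plus (var ''a'') (Num 1))) Skip) s 2
        (\<lambda>s'. s' ''i'' 0 = k \<and> I (Suc k) (s'(''i'' := (s' ''i'')(0 := Suc k))))"
      by (intro runs_loop_free) (use I in \<open>simp_all add: I_def base_upd card_filter_Suc del: lessThan_iff\<close>)
  qed (use n in \<open>auto simp: I_def\<close>)
  have inner: "runs (For ''j'' count_step) s (2 + n * (4 + 2)) (K k n)"
    if k: "k < n" and s: "K k 0 (s(''j'' := (s ''j'')(0 := 0)))" for k s
  proof (rule runs_For[where I = "K k", OF s])
    fix l s assume l: "l < n" and K: "K k l s"
    have e: "(k \<noteq> l \<and> s ''input'' (s ''row'' k + l) = 0) = N k l"
      using K k l unfolding K_def base_def has_graph_def N_eq by auto
    have eqs: "s ''output'' = f" "s ''i'' 0 = k" "s ''j'' 0 = l" "s ''n'' 0 = n" "s ''a'' 0 = a"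
      using K n unfolding K_def base_def by auto
    have rows: "x_row a (Suc l) k = x_row a l k + (if N k l then a else 0)"
      "y_row f (Suc l) k = y_row f l k + (if N k l \<and> f k = f l then n else 0)"
      by (simp_all add: x_row_def y_row_def)
    show "runs count_step s 4 (\<lambda>s'. s' ''j'' 0 = l \<and> K k (Suc l) (s'(''j'' := (s' ''j'')(0 := Suc l))))"
    proof (rule runs_loop_free)
      show "result count_step s ''j'' 0 = l \<and>
          K k (Suc l) ((result count_step s)(''j'' := (result count_step s ''j'')(0 := Suc l)))"
        using K by (simp add: count_step_def K_def base_upd rows e eqs)
    qed (simp_all add: count_step_def)
  qed (use n in \<open>auto simp: K_def\<close>)
  have second: "runs (For ''i'' (Seq (set_var ''y'' (Plus (var ''y'') (var ''a''))) (For ''j'' count_step))) s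
      (2 + n * ((1 + (2 + n * (4 + 2))) + 2)) (J n)" if "I n s" for s
  proof (rule runs_For[where I = J])
    show "J 0 (s(''i'' := (s ''i'')(0 := 0)))"
      using that by (simp add: I_def J_def base_upd a_def)
  next
    fix k s assume k: "k < n" and J: "J k s"
    show "runs (Seq (set_var ''y'' (Plus (var ''y'') (var ''a''))) (For ''j'' count_step)) s
        (1 + (2 + n * (4 + 2)))
        (\<lambda>s'. s' ''i'' 0 = k \<and> J (Suc k) (s'(''i'' := (s' ''i'')(0 := Suc k))))"
    proof (rule runs_Seq)
      show "runs (set_var ''y'' (Plus (var ''y'') (var ''a''))) s 1
          (\<lambda>s. K k 0 (s(''j'' := (s ''j'')(0 := 0))))"
        by (rule runs_loop_free) (use J in \<open>simp_all add: J_def K_def base_upd x_row_def y_row_def\<close>)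
    next
      fix s assume K: "K k 0 (s(''j'' := (s ''j'')(0 := 0)))"
      show "runs (For ''j'' count_step) s (2 + n * (4 + 2))
          (\<lambda>s'. s' ''i'' 0 = k \<and> J (Suc k) (s'(''i'' := (s' ''i'')(0 := Suc k))))"
        by (rule runs_mono[OF inner[OF k K]]) (simp_all add: J_def K_def base_upd)
    qed
  qed (use n in \<open>auto simp: J_def\<close>)
  have "runs count s ((2 + n * (2 + 2)) + (2 + n * ((1 + (2 + n * (4 + 2))) + 2))) (J n)"
    unfolding count_def by (rule runs_Seq[OF first second])
  then show ?thesis
    by (rule runs_mono) (simp_all add: J_def base_def a_def)
qed

lemma runs_finish:
  assumes s: "has_graph s"
  shows "runs finish s ((1 + (2 + n * (1 + 2))) + 1)
    (\<lambda>s'. s' ''output_length'' 0 = n \<and>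
      (\<forall>v<n. s' ''output'' v = (if s ''y'' 0 < s ''x'' 0 then s ''output'' v else 0)))"
proof -
  define R where "R s' \<longleftrightarrow> s' ''n'' 0 = n \<and>
      (\<forall>v<n. s' ''output'' v = (if s ''y'' 0 < s ''x'' 0 then s ''output'' v else 0))" for s' :: store
  have n: "s ''n'' 0 = n" using s unfolding has_graph_def by simp
  have zero: "runs (For ''i'' (Assign ''output'' (var ''i'') (Num 0))) s (2 + n * (1 + 2))
      (\<lambda>s'. s' ''i'' 0 = n \<and> s' ''n'' 0 = n \<and> (\<forall>v<n. s' ''output'' v = 0))"
    by (rule runs_For[where I = "\<lambda>k s'. s' ''i'' 0 = k \<and> s' ''n'' 0 = n \<and> (\<forall>v<k. s' ''output'' v = 0)"])
      (use n in \<open>auto intro!: runs_loop_free\<close>)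
  have "runs (Cond (Less (var ''y'') (var ''x'')) Skip (For ''i'' (Assign ''output'' (var ''i'') (Num 0)))) s
      (1 + (2 + n * (1 + 2))) R"
  proof (rule runs_Cond)
    assume "bval (Less (var ''y'') (var ''x'')) s"
    then show "runs Skip s (2 + n * (1 + 2)) R"
      by (intro runs_loop_free) (simp_all add: R_def n)
  next
    assume "\<not> bval (Less (var ''y'') (var ''x'')) s"
    then show "runs (For ''i'' (Assign ''output'' (var ''i'') (Num 0))) s (2 + n * (1 + 2)) R"
      by (intro runs_mono[OF zero]) (simp_all add: R_def)
  qed
  then show ?thesis
    unfolding finish_def
  proof (rule runs_Seq)
    fix s' assume "R s'"
    then show "runs (set_var ''output_length'' (var ''n'')) s' 1 (\<lambda>s'. s' ''output_length'' 0 = n \<and>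
      (\<forall>v<n. s' ''output'' v = (if s ''y'' 0 < s ''x'' 0 then s ''output'' v else 0)))"
      by (intro runs_loop_free) (simp_all add: R_def)
  qed
qed

text \<open>Part 2 contains no non-edge, so the ordered non-edges with equally coloured ends are
  those inside part 1.\<close>

lemma count_values:
  assumes b: "bounds {..<n} {v \<in> {..<n}. f v = 1}" and f: "\<forall>v<n. f v = 1 \<or> f v = 2"
  shows "(\<Sum>u<n. x_row a n u) = pairs {..<n} * a"
    and "(\<Sum>u<n. a + y_row f n u) = n * (a + pairs {v \<in> {..<n}. f v = 1})"
proof -
  show "(\<Sum>u<n. x_row a n u) = pairs {..<n} * a"
    unfolding x_row_def sum_if_card pairs_def by simp
  have "{(u, v). u < n \<and> v < n \<and> N u v \<and> f u = f v} =
      {(u, v). u \<in> {v \<in> {..<n}. f v = 1} \<and> v \<in> {v \<in> {..<n}. f v = 1} \<and> N u v}"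
  proof -
    have "\<not> N u v" if "u < n" "v < n" "f u = 2" "f v = 2" for u v
      using b that unfolding bounds_def by auto
    then show ?thesis using f by fastforce
  qed
  then show "(\<Sum>u<n. a + y_row f n u) = n * (a + pairs {v \<in> {..<n}. f v = 1})"
    unfolding sum.distrib y_row_def sum_if_card pairs_def by (simp add: algebra_simps)
qed

lemma label_classes_map:
  "label_classes (map f [0..<n]) = (\<lambda>l. {v \<in> {..<n}. f v = l}) ` f ` {..<n}"
  unfolding label_classes_def by (auto simp: image_iff atLeast0LessThan)

lemma label_classes_correct:
  assumes b: "bounds {..<n} A" and A: "A = {v \<in> {..<n}. f v = 1}" and f: "\<forall>v<n. f v = 1 \<or> f v = 2"
    and g: "\<forall>v<n. g v = (if n * (card A + pairs A) < pairs {..<n} * card A then f v else 0)"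
  shows "max_dense_partition {..<n} E (label_classes (map g [0..<n]))"
proof -
  have ne: "{..<n} \<noteq> {}" using n_pos by (simp add: lessThan_empty_iff)
  show ?thesis
  proof (cases "n * (card A + pairs A) < pairs {..<n} * card A")
    case True
    then have opt: "A \<noteq> {}" "A \<noteq> {..<n}" "max_dense_partition {..<n} E {A, {..<n} - A}"
      using optimal_partition[OF b ne] by auto
    \<comment> \<open>Both colours occur because \<open>A\<close> is neither empty nor everything;
      so there are exactly two label classes.\<close>
    have "f ` {..<n} = {1, 2}"
    proof (intro equalityI subsetI)
      fix l assume "l \<in> f ` {..<n}"
      then show "l \<in> {1, 2}" using f by auto
    next
      fix l :: nat assume "l \<in> {1, 2}"
      moreover have "\<exists>v<n. f v = 1" using opt(1) A by auto
      moreover have "\<exists>v<n. f v = 2" using opt(2) A f by auto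
      ultimately have "\<exists>v<n. f v = l" by blast
      then show "l \<in> f ` {..<n}" by auto
    qed
    moreover have "{v \<in> {..<n}. f v = 2} = {..<n} - A"
      using f A by auto
    ultimately have "label_classes (map f [0..<n]) = {A, {..<n} - A}"
      unfolding label_classes_map A by simp
    moreover have "map g [0..<n] = map f [0..<n]"
      using g True by simp
    ultimately show ?thesis using opt(3) by (simp only:)
  next
    case False
    then have "map g [0..<n] = map (\<lambda>_. 0) [0..<n]"
      using g by (intro map_cong) auto
    moreover have "label_classes (map (\<lambda>_. 0) [0..<n]) = {{..<n}}"
      unfolding label_classes_map using ne by auto
    moreover have "max_dense_partition {..<n} E {{..<n}}"
      using optimal_partition[OF b ne] False by simp
    ultimately show ?thesis by (simp only:)
  qed
qed

lemma runs_solver: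
  "runs solver start (57 * length (encode_graph (n, E)))
    (\<lambda>s. s ''output_length'' 0 = n \<and> max_dense_partition {..<n} E (label_classes (output_of s)))"
proof -
  define Q where "Q s \<longleftrightarrow> s ''output_length'' 0 = n \<and>
    max_dense_partition {..<n} E (label_classes (output_of s))" for s
  have fin: "runs (Seq count finish) s
      (((2 + n * (2 + 2)) + (2 + n * ((1 + (2 + n * (4 + 2))) + 2))) + ((1 + (2 + n * (1 + 2))) + 1)) Q"
    if s: "ready s \<and> valid_colouring s \<and> coloured s = {..<n}" for s
  proof (rule runs_Seq[OF runs_count[OF conjunct1[OF s] refl]])
    define A where "A = part_1 s"
    have b: "bounds {..<n} A"
    proof -
      have "greedy_state (coloured s) (part_1 s) (s ''w'' 0)"
        using s unfolding valid_colouring_def by blast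
      then have "bounds (coloured s) (part_1 s)"
        by (rule greedy_state_bounds)
      then show ?thesis using s unfolding A_def by (simp only:)
    qed
    have f: "\<forall>v<n. s ''output'' v = 1 \<or> s ''output'' v = 2"
    proof (intro allI impI)
      fix v assume "v < n"
      then have "v \<in> coloured s" using s by simp
      moreover have "s ''output'' v \<le> 2" using s unfolding valid_colouring_def by blast
      ultimately show "s ''output'' v = 1 \<or> s ''output'' v = 2" by auto
    qed
    fix s1 assume s1: "has_graph s1 \<and> s1 ''output'' = s ''output'' \<and>
      s1 ''x'' 0 = (\<Sum>u<n. x_row (card (part_1 s)) n u) \<and>
      s1 ''y'' 0 = (\<Sum>u<n. card (part_1 s) + y_row (s ''output'') n u)"
    then have xy: "s1 ''x'' 0 = pairs {..<n} * card A" "s1 ''y'' 0 = n * (card A + pairs A)"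
      using count_values[of "s ''output''"] b f unfolding A_def by auto
    show "runs finish s1 ((1 + (2 + n * (1 + 2))) + 1) Q"
    proof (rule runs_mono[OF runs_finish[OF conjunct1[OF s1]]])
      fix s2 assume "s2 ''output_length'' 0 = n \<and>
        (\<forall>v<n. s2 ''output'' v = (if s1 ''y'' 0 < s1 ''x'' 0 then s1 ''output'' v else 0))"
      then show "Q s2"
        using label_classes_correct[OF b A_def f, of "s2 ''output''"] s1 xy
        unfolding Q_def output_of_def by simp
    qed simp
  qed
  have "runs solver start ((4 + n * (5 + n * 4)) + ((2 + n * ((1 + (2 + n * (6 + 2)) + 3) + 2)) +
      (((2 + n * (2 + 2)) + (2 + n * ((1 + (2 + n * (4 + 2))) + 2))) + ((1 + (2 + n * (1 + 2))) + 1)))) Q"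
    unfolding solver_def
  proof (rule runs_Seq[OF runs_prepare])
    fix s assume "ready s \<and> s ''output'' = (\<lambda>_. 0) \<and> s ''w'' 0 = 0"
    then show "runs (Seq colour (Seq count finish)) s ((2 + n * ((1 + (2 + n * (6 + 2)) + 3) + 2)) +
      (((2 + n * (2 + 2)) + (2 + n * ((1 + (2 + n * (4 + 2))) + 2))) + ((1 + (2 + n * (1 + 2))) + 1))) Q"
      by (intro runs_Seq[OF runs_colour fin]) auto
  qed
  \<comment> \<open>The budgets of the four phases add up to this polynomial. With
    \<open>n \<le> n * n\<close> and the encoding of length \<open>n * n + 1\<close>, the sum 57 of
    its coefficients serves as the factor.\<close>
  then have "runs solver start (18 * (n * n) + 25 * n + 14) Q"
    by (rule runs_mono) (simp_all add: algebra_simps)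
  then show ?thesis
  proof (rule runs_mono)
    show "18 * (n * n) + 25 * n + 14 \<le> 57 * length (encode_graph (n, E))"
    proof -
      define m where "m = n * n"
      have "n \<le> m" by (simp add: m_def)
      then show ?thesis unfolding length_encode m_def[symmetric] mult_Suc_right by linarith
    qed
  qed (simp add: Q_def)
qed

end

section \<open>From the minimum degree to the theorem\<close>

text \<open>Of the n - 1 other vertices at least n - 3 are neighbours of \<open>u\<close>, since
  distinct edges at \<open>u\<close> have distinct other ends.\<close>

lemma card_non_neighbours_le_2:
  assumes G: "simple_graph {..<n} E" and d: "int (min_degree {..<n} E) \<ge> int n - 3" and u: "u < n"
  shows "card {v \<in> {..<n}. u \<noteq> v \<and> {u, v} \<notin> E} \<le> 2"
proof -
  let ?B = "{v \<in> {..<n}. {u, v} \<in> E}" and ?C = "{v \<in> {..<n}. u \<noteq> v \<and> {u, v} \<notin> E}"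
  have e: "e \<subseteq> {..<n}" "card e = 2" if "e \<in> E" for e
    using G that unfolding simple_graph_def by auto
  have "{e \<in> E. u \<in> e} \<subseteq> (\<lambda>v. {u, v}) ` ?B"
  proof
    fix e assume "e \<in> {e \<in> E. u \<in> e}"
    then have eE: "e \<in> E" "u \<in> e" by auto
    then obtain x y where "e = {x, y}" using e(2)[of e] unfolding card_2_iff by auto
    then obtain v where "e = {u, v}" using eE by auto
    then show "e \<in> (\<lambda>v. {u, v}) ` ?B" using eE e(1)[of e] by auto
  qed
  then have "card {e \<in> E. u \<in> e} \<le> card ((\<lambda>v. {u, v}) ` ?B)"
    by (intro card_mono) auto
  also have "\<dots> \<le> card ?B"
    by (rule card_image_le) auto
  finally have "vertex_degree E u \<le> card ?B"
    unfolding vertex_degree_def .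
  moreover have "min_degree {..<n} E \<le> vertex_degree E u"
    unfolding min_degree_def using u by (intro Min_le) auto
  moreover have "card ({u} \<union> (?B \<union> ?C)) = 1 + (card ?B + card ?C)"
  proof -
    have "u \<notin> ?B" using e(2)[of "{u, u}"] by auto
    moreover have "?B \<inter> ?C = {}" by auto
    ultimately show ?thesis by (simp add: card_Un_disjoint)
  qed
  moreover have "{u} \<union> (?B \<union> ?C) = {..<n}"
    using u by auto
  ultimately show ?thesis
    using d by simp
qed

theorem theorem20:
  shows "poly_time_solvable encode_graph MaxDenseGraphPartition
    {(n, E). n \<ge> 1 \<and> simple_graph {..<n} E \<and> int (min_degree {..<n} E) \<ge> int n - 3}"
  unfolding poly_time_solvable_def
\<comment> \<open>The polynomial is 57 times the length of the encoding: the time is linear in the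
  size of the adjacency matrix.\<close>
proof (intro exI[of _ solver] exI[of _ "[:0, 57:]"] ballI)
  fix G :: "nat \<times> nat set set"
  assume "G \<in> {(n, E). n \<ge> 1 \<and> simple_graph {..<n} E \<and> int (min_degree {..<n} E) \<ge> int n - 3}"
  then obtain n E where G: "G = (n, E)" "n \<ge> 1" "simple_graph {..<n} E"
      "int (min_degree {..<n} E) \<ge> int n - 3"
    by auto
  interpret machine_graph n "\<lambda>u v. u \<noteq> v \<and> {u, v} \<notin> E" E
    by unfold_locales
      (use G card_non_neighbours_le_2 in \<open>auto simp: insert_commute\<close>)
  obtain t s where ts: "exec solver (input_store (encode_graph G)) t s"
      "t \<le> 57 * length (encode_graph G)" "s ''output_length'' 0 = n"
      "max_dense_partition {..<n} E (label_classes (output_of s))"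
    using runs_solver unfolding runs_def G(1) by blast
  have len: "length (output_of s) = n"
    using ts(3) by (simp add: output_of_def)
  have "n \<le> Suc (n * n)"
    by (simp add: le_SucI)
  also have "\<dots> \<le> 57 * length (encode_graph G)"
    unfolding G(1) length_encode by simp
  finally have "n \<le> 57 * length (encode_graph G)" .
  then show "\<exists>t s. exec solver (input_store (encode_graph G)) t s \<and>
      t \<le> poly [:0, 57:] (length (encode_graph G)) \<and>
      length (output_of s) \<le> poly [:0, 57:] (length (encode_graph G)) \<and>
      MaxDenseGraphPartition G (output_of s)"
    using ts len by (intro exI[of _ t] exI[of _ s]) (simp add: MaxDenseGraphPartition_def G(1) mult.commute)
qed

end
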